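(* Let $\{A(t)\}_{t\ge0}$ be a continuous time (time-varying) chain of $N\times N$ matrices with infinite flow graph $\mathcal H_2$. Then $$\mathbf{rank}(A)\le N-h'_2,$$ where $h'_2$ is the number of connected components of $\mathcal H_2$ containing two or more nodes.
   Context: Let $\mathcal V=\{1,\dots,N\}$. A continuous time chain $\{A(t)\}_{t\ge0}$ is a family of real $N\times N$ matrices $A(t)=(a_{ij}(t))$ with zero row sums and non-negative off-diagonal entries, whose entries are measurable and locally integrable functions of $t\in[0,\infty)$. Let $\Phi(t,\tau)$, $t\ge\tau\ge0$, be the state transition matrix of $\dot x(t)=A(t)x(t)$, so $x(t)=\Phi(t,\tau)x(\tau)$; it is invertible and row-stochastic. Rank: for $\tau\ge0$ let $\mathbf{null}_\tau(A)=\{v\in\mathbb R^N : \lim_{t\to\infty}\Phi(t,\tau)v=\mathbf 0_N\}$. This is a vector space whose dimension does not depend on $\tau$; this dimension is $\mathbf{nullity}(A)$, and $\mathbf{rank}(A)=N-\mathbf{nullity}(A)$. Infinite flow graph: the undirected graph $\mathcal H_2(\mathcal V,\mathcal E_2)$ in which distinct $i,j\in\mathcal V$ are linked if and only if $\int_0^\infty (a_{ij}(t)+a_{ji}(t))\,dt=\infty$. *)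

theory Defs
  imports "HOL-Analysis.Analysis"
begin

text \<open>The node set is a finite index type \<open>'n\<close>, so that \<open>N = CARD('n)\<close>.
  Conditions on a chain concern times \<open>t \<ge> 0\<close> only.\<close>

text \<open>Absolute integrability (with respect to Lebesgue measure) on every \<open>{0..T}\<close> is
  measurability plus local integrability on \<open>[0,\<infinity>)\<close>.\<close>

definition ct_chain :: "(real \<Rightarrow> real^'n^'n) \<Rightarrow> bool" where
  "ct_chain A \<longleftrightarrow>
     (\<forall>t\<ge>0. \<forall>i. (\<Sum>j\<in>UNIV. A t $ i $ j) = 0) \<and>
     (\<forall>t\<ge>0. \<forall>i j. i \<noteq> j \<longrightarrow> 0 \<le> A t $ i $ j) \<and>
     (\<forall>i j. \<forall>T\<ge>0. (\<lambda>t. A t $ i $ j) absolutely_integrable_on {0..T})"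

text \<open>As the coefficients are only locally integrable, \<open>x' = A x\<close> is understood in the sense
  of Caratheodory (locally absolutely continuous \<open>x\<close> with the equation holding almost
  everywhere), which is the integral equation below.\<close>

definition is_solution :: "(real \<Rightarrow> real^'n^'n) \<Rightarrow> real \<Rightarrow> (real \<Rightarrow> real^'n) \<Rightarrow> bool" where
  "is_solution A \<tau> x \<longleftrightarrow>
     continuous_on {\<tau>..} x \<and>
     (\<forall>t\<ge>\<tau>. ((\<lambda>s. A s *v x s) has_integral (x t - x \<tau>)) {\<tau>..t})"

text \<open>For a chain and \<open>t \<ge> \<tau> \<ge> 0\<close> the matrix below exists and is unique, because each initial
  value at \<open>\<tau>\<close> determines exactly one solution and the solutions form a vector space.\<close>

definition state_transition :: "(real \<Rightarrow> real^'n^'n) \<Rightarrow> real \<Rightarrow> real \<Rightarrow> real^'n^'n" where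
  "state_transition A t \<tau> = (THE M. \<forall>x. is_solution A \<tau> x \<longrightarrow> x t = M *v x \<tau>)"

definition null_space :: "(real \<Rightarrow> real^'n^'n) \<Rightarrow> real \<Rightarrow> (real^'n) set" where
  "null_space A \<tau> = {v. ((\<lambda>t. state_transition A t \<tau> *v v) \<longlongrightarrow> 0) at_top}"

text \<open>The dimension of \<open>null_space A \<tau>\<close> is the same for all \<open>\<tau> \<ge> 0\<close>; it is taken at \<open>\<tau> = 0\<close>.\<close>

definition chain_nullity :: "(real \<Rightarrow> real^'n^'n) \<Rightarrow> nat" where
  "chain_nullity A = dim (null_space A 0)"

definition chain_rank :: "(real \<Rightarrow> real^'n^'n) \<Rightarrow> nat" where
  "chain_rank A = CARD('n) - chain_nullity A"

text \<open>The graph is given by its (symmetric) adjacency relation; the integrand is non-negative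
  for a chain since \<open>i \<noteq> j\<close>.\<close>

definition infinite_flow_graph :: "(real \<Rightarrow> real^'n^'n) \<Rightarrow> ('n \<times> 'n) set" where
  "infinite_flow_graph A =
     {(i, j). i \<noteq> j \<and>
        (\<integral>\<^sup>+t\<in>{0..}. ennreal (A t $ i $ j + A t $ j $ i) \<partial>lebesgue) = \<infinity>}"

text \<open>For symmetric \<open>E\<close> the relation \<open>E\<^sup>*\<close> is an equivalence, whose classes are the vertex sets
  of the connected components.\<close>

definition graph_components :: "('n \<times> 'n) set \<Rightarrow> 'n set set" where
  "graph_components E = UNIV // E\<^sup>*"

definition num_nontrivial_components :: "('n::finite \<times> 'n) set \<Rightarrow> nat" where
  "num_nontrivial_components E = card {C \<in> graph_components E. 2 \<le> card C}"

end

theory Submission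
  imports Defs
begin

text \<open>Write \<open>\<Phi>(t,\<tau>)\<close> for the state transition matrix. Solutions do not increase in the maximum
  norm, so if \<open>P\<close> is any limit of \<open>\<Phi>(s\<^sub>k,0)\<close> with \<open>s\<^sub>k \<rightarrow> \<infinity>\<close>, then the null space of the chain
  contains the kernel of \<open>P\<close>. Choosing \<open>k\<close> and then \<open>l\<close> large along such a sequence,
  \<open>\<Phi>(s\<^sub>l,s\<^sub>k) \<Phi>(s\<^sub>k,0) = \<Phi>(s\<^sub>l,0)\<close> gives a limit \<open>Q\<close> of \<open>\<Phi>(s\<^sub>l,s\<^sub>k)\<close> with \<open>Q P = P\<close>, whence
  \<open>rank P \<le> rank Q\<close>. Let \<open>C\<close> be a component with at least two nodes. The total flow between \<open>C\<close>
  and its complement after time \<open>s\<^sub>k\<close> tends to \<open>0\<close>. Hence the entries of \<open>\<Phi>(s\<^sub>l,s\<^sub>k)\<close> with row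
  outside \<open>C\<close> and column in \<open>C\<close> tend to \<open>0\<close>, and the determinant \<open>y\<close> of its diagonal block on \<open>C\<close>
  satisfies \<open>y' = (\<Sum>i\<in>C. a\<^sub>i\<^sub>i) y\<close> up to an error with small integral. The trace term integrates
  to \<open>-\<infinity>\<close> because \<open>C\<close> contains an edge, so the block of \<open>Q\<close> is singular and \<open>Q\<close> kills a non-zero
  vector supported on \<open>C\<close>. These vectors are independent for distinct components.\<close>

section \<open>Primitives of locally integrable functions\<close>

text \<open>Induction on the number of steps of length \<open>d/2\<close> that lead from
  \<open>a\<close> to \<open>t\<close>; halving \<open>d\<close> keeps each step strictly shorter
  than \<open>d\<close>.\<close>

lemma decreasing_if_locally_decreasing:
  fixes K :: "real \<Rightarrow> real"
  assumes "d > 0" "a \<le> b"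
    and loc: "\<And>s t. \<lbrakk>a \<le> s; s \<le> t; t \<le> b; t - s < d\<rbrakk> \<Longrightarrow> K t \<le> K s"
  shows "K b \<le> K a"
proof -
  have "\<lbrakk>a \<le> t; t \<le> b; t - a \<le> real n * (d/2)\<rbrakk> \<Longrightarrow> K t \<le> K a" for n t
  proof (induction n arbitrary: t)
    case (Suc n)
    let ?s = "max a (t - d/2)"
    have "K ?s \<le> K a"
      using Suc.prems \<open>d > 0\<close> by (intro Suc.IH) (auto simp: max_def algebra_simps)
    moreover have "K t \<le> K ?s"
      using Suc.prems \<open>d > 0\<close> by (intro loc) (auto simp: max_def)
    ultimately show ?case by simp
  qed auto
  moreover obtain n where n: "(b - a) / (d/2) \<le> real n"
    using real_arch_simple by blast
  have "b - a \<le> real n * (d/2)"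
    using n \<open>d > 0\<close> by (simp add: pos_divide_le_eq)
  ultimately show ?thesis
    using assms(2) by blast
qed

text \<open>The form in which pointwise differential inequalities are integrated below: the
  error term only has to be small relative to the increment of a fixed function \<open>m\<close>.\<close>

lemma le_if_local_increment_le:
  fixes K m :: "real \<Rightarrow> real"
  assumes "a \<le> b"
    and loc: "\<And>e. e > 0 \<Longrightarrow> \<exists>d>0. \<forall>s t. a \<le> s \<longrightarrow> s \<le> t \<longrightarrow> t \<le> b \<longrightarrow> t - s < d \<longrightarrow>
                K t - K s \<le> e * (m t - m s)"
  shows "K b \<le> K a"
proof -
  have "K b - K a \<le> e * (m b - m a)" if "e > 0" for e
  proof -
    obtain d where "d > 0" and d: "\<And>s t. \<lbrakk>a \<le> s; s \<le> t; t \<le> b; t - s < d\<rbrakk> \<Longrightarrow>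
                K t - K s \<le> e * (m t - m s)"
      using loc[OF \<open>e > 0\<close>] by blast
    have d': "K t - e * m t \<le> K s - e * m s" if "a \<le> s" "s \<le> t" "t \<le> b" "t - s < d" for s t
      using d[OF that] by (simp add: algebra_simps)
    have "K b - e * m b \<le> K a - e * m a"
      by (rule decreasing_if_locally_decreasing[OF \<open>d > 0\<close> \<open>a \<le> b\<close>, of "\<lambda>t. K t - e * m t"])
         (fact d')
    then show ?thesis by (simp add: algebra_simps)
  qed
  note * = this
  have "K b - K a \<le> 0 + e" if "e > 0" for e
  proof -
    \<comment> \<open>The added 1 keeps the divisor positive when \<open>m b = m a\<close>.\<close>
    let ?c = "\<bar>m b - m a\<bar> + 1"
    have "K b - K a \<le> e / ?c * (m b - m a)"
      using that by (intro *) (auto intro!: divide_pos_pos)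
    also have "\<dots> \<le> e / ?c * ?c"
      using that by (intro mult_left_mono) auto
    finally show ?thesis by simp
  qed
  then have "K b - K a \<le> 0"
    by (rule field_le_epsilon)
  then show ?thesis by simp
qed

text \<open>This encodes that \<open>f\<close> is locally absolutely continuous on
  \<open>{a..}\<close> with almost-everywhere derivative \<open>u\<close>. Absolute integrability is
  demanded separately because gauge integrability does not give it, and the integrals of
  \<open>\<bar>u r\<bar>\<close> and of products with continuous functions below rely on it.\<close>

definition primitive :: "real \<Rightarrow> (real \<Rightarrow> real) \<Rightarrow> (real \<Rightarrow> real) \<Rightarrow> bool" where
  "primitive a f u \<longleftrightarrow>
     (\<forall>t\<ge>a. u absolutely_integrable_on {a..t} \<and> (u has_integral (f t - f a)) {a..t})"

lemma primitiveI:
  assumes "\<And>t. a \<le> t \<Longrightarrow> u absolutely_integrable_on {a..t}"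
    and "\<And>t. a \<le> t \<Longrightarrow> (u has_integral (f t - f a)) {a..t}"
  shows "primitive a f u"
  using assms by (auto simp: primitive_def)

lemma abs_integrable_subinterval:
  fixes u :: "real \<Rightarrow> real"
  shows "\<lbrakk>u absolutely_integrable_on {a..b}; a \<le> s; t \<le> b\<rbrakk> \<Longrightarrow> u absolutely_integrable_on {s..t}"
  by (rule absolutely_integrable_on_subinterval) auto

lemma primitive_abs_integrable:
  "\<lbrakk>primitive a f u; a \<le> s\<rbrakk> \<Longrightarrow> u absolutely_integrable_on {s..t}"
  unfolding primitive_def
  by (rule abs_integrable_subinterval[where a=a and b="max a t"]) auto

lemma primitive_integrable:
  "\<lbrakk>primitive a f u; a \<le> s\<rbrakk> \<Longrightarrow> u integrable_on {s..t}"
  using primitive_abs_integrable set_lebesgue_integral_eq_integral(1) by blast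

lemma primitive_increment:
  assumes "primitive a f u" "a \<le> s" "s \<le> t"
  shows "(u has_integral (f t - f s)) {s..t}"
proof -
  have "integral {a..s} u + integral {s..t} u = integral {a..t} u"
    using assms by (intro Henstock_Kurzweil_Integration.integral_combine)
                   (auto intro: primitive_integrable)
  moreover have "integral {a..s} u = f s - f a" "integral {a..t} u = f t - f a"
    using assms by (auto simp: primitive_def intro!: integral_unique)
  ultimately have "integral {s..t} u = f t - f s" by simp
  then show ?thesis
    using integrable_integral[OF primitive_integrable[OF assms(1,2), of t]] by simp
qed

lemma primitive_restrict:
  "\<lbrakk>primitive a f u; a \<le> b\<rbrakk> \<Longrightarrow> primitive b f u"
  by (rule primitiveI) (auto intro: primitive_abs_integrable primitive_increment)

lemma primitive_continuous:
  assumes "primitive a f u"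
  shows "continuous_on {a..b} f"
proof -
  have "continuous_on {a..b} (\<lambda>t. f a + integral {a..t} u)"
    using assms by (intro continuous_intros indefinite_integral_continuous_1 primitive_integrable) auto
  moreover have "f a + integral {a..t} u = f t" if "t \<in> {a..b}" for t
    using assms that integral_unique[of u "f t - f a" "{a..t}"] by (simp add: primitive_def)
  ultimately show ?thesis
    by (rule continuous_on_eq) simp
qed

lemma primitive_integral:
  assumes "\<And>t. a \<le> t \<Longrightarrow> u absolutely_integrable_on {a..t}"
  shows "primitive a (\<lambda>t. integral {a..t} u) u"
proof (rule primitiveI)
  fix t assume "a \<le> t"
  then show "(u has_integral integral {a..t} u - integral {a..a} u) {a..t}"
    using set_lebesgue_integral_eq_integral(1)[OF assms] by (simp add: integrable_integral)
qed (fact assms)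

section \<open>Algebra of primitives: linearity, comparison and the product rule\<close>

lemma primitive_const: "primitive a (\<lambda>_. c) (\<lambda>_. 0)"
  by (simp add: primitive_def set_integrable_def)

lemma primitive_cmult: "primitive a f u \<Longrightarrow> primitive a (\<lambda>t. c * f t) (\<lambda>t. c * u t)"
  unfolding primitive_def right_diff_distrib[symmetric]
  by (simp add: has_integral_mult_right)

lemma primitive_add:
  "\<lbrakk>primitive a f u; primitive a g v\<rbrakk> \<Longrightarrow> primitive a (\<lambda>t. f t + g t) (\<lambda>t. u t + v t)"
  by (intro primitiveI) (auto simp: primitive_def add_diff_add intro: has_integral_add)

lemma primitive_sum:
  assumes "\<And>i. i \<in> I \<Longrightarrow> primitive a (f i) (u i)"
  shows "primitive a (\<lambda>t. \<Sum>i\<in>I. f i t) (\<lambda>t. \<Sum>i\<in>I. u i t)"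
  using assms
proof (induction I rule: infinite_finite_induct)
  case (insert i I)
  then show ?case by (simp add: primitive_add)
qed (simp_all add: primitive_const)

lemma primitive_cong:
  assumes "primitive a f u" "\<And>t. a \<le> t \<Longrightarrow> f t = g t" "\<And>t. a \<le> t \<Longrightarrow> u t = v t"
  shows "primitive a g v"
proof (rule primitiveI)
  fix t assume "a \<le> t"
  have "u absolutely_integrable_on {a..t}"
    using assms(1) \<open>a \<le> t\<close> by (auto simp: primitive_def)
  moreover have "(\<lambda>x. indicator {a..t} x *\<^sub>R u x) = (\<lambda>x. indicator {a..t} x *\<^sub>R v x)"
    using assms(3) by (auto simp: fun_eq_iff indicator_def)
  ultimately show "v absolutely_integrable_on {a..t}"
    by (simp add: set_integrable_def)
  have "(u has_integral (g t - g a)) {a..t}"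
    using assms(1,2) \<open>a \<le> t\<close> by (auto simp: primitive_def)
  then show "(v has_integral (g t - g a)) {a..t}"
    by (rule has_integral_eq[rotated]) (use assms(3) in auto)
qed

lemma abs_integrable_continuous_mult:
  fixes f g :: "real \<Rightarrow> real"
  assumes "continuous_on {a..b} f" "g absolutely_integrable_on {a..b}"
  shows "(\<lambda>x. f x * g x) absolutely_integrable_on {a..b}"
  using assms
  by (intro absolutely_integrable_bounded_measurable_product_real
        continuous_imp_measurable_on_sets_lebesgue compact_imp_bounded compact_continuous_image) auto

lemma primitive_mono:
  assumes "primitive a f u" "primitive a g v" "a \<le> s" "s \<le> t"
    and "\<And>r. \<lbrakk>s \<le> r; r \<le> t\<rbrakk> \<Longrightarrow> u r \<le> v r"
  shows "f t - f s \<le> g t - g s"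
  by (rule has_integral_le[OF primitive_increment[OF assms(1,3,4)] primitive_increment[OF assms(2,3,4)]])
     (use assms(5) in auto)

text \<open>On a short interval the increment of \<open>f * g\<close> is the integral of
  \<open>g s * u r + f t * v r\<close>. By uniform continuity this integrand differs from the
  claimed derivative by at most \<open>e * (\<bar>u r\<bar> + \<bar>v r\<bar>)\<close>. So
  \<open>le_if_local_increment_le\<close>, applied to \<open>f * g - P\<close> and to its negative,
  shows that this difference is constant.\<close>

lemma primitive_mult:
  assumes f: "primitive a f u" and g: "primitive a g v"
  shows "primitive a (\<lambda>t. f t * g t) (\<lambda>t. u t * g t + f t * v t)"
proof -
  let ?w = "\<lambda>t. u t * g t + f t * v t"
  have w: "?w absolutely_integrable_on {a..t}" for t
    using abs_integrable_continuous_mult[OF primitive_continuous[OF g] primitive_abs_integrable[OF f order_refl]]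
      abs_integrable_continuous_mult[OF primitive_continuous[OF f] primitive_abs_integrable[OF g order_refl]]
    by (intro set_integral_add) (auto simp: mult.commute)
  define P where "P t = integral {a..t} ?w" for t
  have P: "primitive a P ?w"
    unfolding P_def by (rule primitive_integral[OF w])
  define m where "m t = integral {a..t} (\<lambda>r. \<bar>u r\<bar> + \<bar>v r\<bar>)" for t
  have m: "primitive a m (\<lambda>r. \<bar>u r\<bar> + \<bar>v r\<bar>)"
    unfolding m_def
    by (intro primitive_integral set_integral_add set_integrable_abs
          primitive_abs_integrable[OF f] primitive_abs_integrable[OF g]) auto
  have loc: "\<exists>d>0. \<forall>s t. a \<le> s \<longrightarrow> s \<le> t \<longrightarrow> t \<le> b \<longrightarrow> t - s < d \<longrightarrow>
                \<bar>(f t * g t - P t) - (f s * g s - P s)\<bar> \<le> e * (m t - m s)" if "e > 0" for e b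
  proof -
    have "uniformly_continuous_on {a..b} f" "uniformly_continuous_on {a..b} g"
      using primitive_continuous f g by (auto intro: compact_uniformly_continuous)
    then obtain d1 d2 where "d1 > 0" "d2 > 0"
      and d1: "\<And>x y. \<lbrakk>x \<in> {a..b}; y \<in> {a..b}; \<bar>y - x\<bar> < d1\<rbrakk> \<Longrightarrow> \<bar>f y - f x\<bar> < e"
      and d2: "\<And>x y. \<lbrakk>x \<in> {a..b}; y \<in> {a..b}; \<bar>y - x\<bar> < d2\<rbrakk> \<Longrightarrow> \<bar>g y - g x\<bar> < e"
      using \<open>e > 0\<close> unfolding uniformly_continuous_on_def dist_real_def by metis
    show ?thesis
    proof (intro exI[of _ "min d1 d2"] conjI allI impI)
      fix s t assume st: "a \<le> s" "s \<le> t" "t \<le> b" "t - s < min d1 d2"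
      \<comment> \<open>Evaluating \<open>g\<close> at the left end and \<open>f\<close> at the
        right end makes the value exactly \<open>f t * g t - f s * g s\<close>.\<close>
      have 1: "((\<lambda>r. g s * u r + f t * v r) has_integral (g s * (f t - f s) + f t * (g t - g s))) {s..t}"
        using st by (intro has_integral_add has_integral_mult_right primitive_increment[OF f] primitive_increment[OF g])
      have 2: "((\<lambda>r. (g s * u r + f t * v r) - ?w r) has_integral
                 (g s * (f t - f s) + f t * (g t - g s)) - (P t - P s)) {s..t}"
        using st by (intro has_integral_diff 1 primitive_increment[OF P])
      have 3: "((\<lambda>r. e * (\<bar>u r\<bar> + \<bar>v r\<bar>)) has_integral e * (m t - m s)) {s..t}"
        using st by (intro has_integral_mult_right primitive_increment[OF m])
      have *: "\<bar>(g s * u r + f t * v r) - ?w r\<bar> \<le> e * (\<bar>u r\<bar> + \<bar>v r\<bar>)" if "r \<in> {s..t}" for r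
      proof -
        have "(g s * u r + f t * v r) - ?w r = (g s - g r) * u r + (f t - f r) * v r"
          by (simp add: algebra_simps)
        also have "\<bar>\<dots>\<bar> \<le> \<bar>g s - g r\<bar> * \<bar>u r\<bar> + \<bar>f t - f r\<bar> * \<bar>v r\<bar>"
          by (metis abs_mult abs_triangle_ineq)
        also have "\<dots> \<le> e * \<bar>u r\<bar> + e * \<bar>v r\<bar>"
          using st that d1[of r t] d2[of r s] by (intro add_mono mult_right_mono) auto
        finally show ?thesis by (simp add: algebra_simps)
      qed
      have "norm (integral {s..t} (\<lambda>r. (g s * u r + f t * v r) - ?w r)) \<le> integral {s..t} (\<lambda>r. e * (\<bar>u r\<bar> + \<bar>v r\<bar>))"
        using 2 3 * by (intro integral_norm_bound_integral) (auto simp: has_integral_integrable)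
      then show "\<bar>(f t * g t - P t) - (f s * g s - P s)\<bar> \<le> e * (m t - m s)"
        unfolding integral_unique[OF 2] integral_unique[OF 3] by (simp add: algebra_simps)
    qed (use \<open>d1 > 0\<close> \<open>d2 > 0\<close> in auto)
  qed
  have eq: "f t * g t - f a * g a = P t - P a" if "a \<le> t" for t
  proof -
    have "f t * g t - P t \<le> f a * g a - P a"
    proof (rule le_if_local_increment_le[OF that, where m=m and K="\<lambda>t. f t * g t - P t"])
      fix e :: real assume "e > 0"
      from loc[OF this, of t] obtain d where "d > 0" and
        d: "\<And>s r. \<lbrakk>a \<le> s; s \<le> r; r \<le> t; r - s < d\<rbrakk> \<Longrightarrow>
              \<bar>(f r * g r - P r) - (f s * g s - P s)\<bar> \<le> e * (m r - m s)"
        by blast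
      then show "\<exists>d>0. \<forall>s r. a \<le> s \<longrightarrow> s \<le> r \<longrightarrow> r \<le> t \<longrightarrow> r - s < d \<longrightarrow>
          (f r * g r - P r) - (f s * g s - P s) \<le> e * (m r - m s)"
        using abs_le_D1 by (intro exI[of _ d] conjI allI impI) auto
    qed
    moreover have "- (f t * g t - P t) \<le> - (f a * g a - P a)"
    proof (rule le_if_local_increment_le[OF that, where m=m and K="\<lambda>t. - (f t * g t - P t)"])
      fix e :: real assume "e > 0"
      from loc[OF this, of t] obtain d where "d > 0" and
        d: "\<And>s r. \<lbrakk>a \<le> s; s \<le> r; r \<le> t; r - s < d\<rbrakk> \<Longrightarrow>
              \<bar>(f r * g r - P r) - (f s * g s - P s)\<bar> \<le> e * (m r - m s)"
        by blast
      show "\<exists>d>0. \<forall>s r. a \<le> s \<longrightarrow> s \<le> r \<longrightarrow> r \<le> t \<longrightarrow> r - s < d \<longrightarrow>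
          - (f r * g r - P r) - - (f s * g s - P s) \<le> e * (m r - m s)"
      proof (intro exI[of _ d] conjI allI impI)
        fix s r assume "a \<le> s" "s \<le> r" "r \<le> t" "r - s < d"
        from d[OF this] show "- (f r * g r - P r) - - (f s * g s - P s) \<le> e * (m r - m s)"
          by linarith
      qed fact
    qed
    ultimately show ?thesis by simp
  qed
  show ?thesis
  proof (rule primitiveI)
    fix t assume "a \<le> t"
    show "(?w has_integral f t * g t - f a * g a) {a..t}"
      unfolding eq[OF \<open>a \<le> t\<close>] by (rule primitive_increment[OF P order_refl \<open>a \<le> t\<close>])
  qed (rule w)
qed

lemma primitive_prod:
  assumes "finite I" "\<And>i. i \<in> I \<Longrightarrow> primitive a (f i) (u i)"
  shows "primitive a (\<lambda>t. \<Prod>i\<in>I. f i t) (\<lambda>t. \<Sum>i\<in>I. u i t * (\<Prod>k\<in>I-{i}. f k t))"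
  using assms
proof (induction I rule: finite_induct)
  case empty
  then show ?case by (simp add: primitive_const)
next
  case (insert j I)
  have "primitive a (\<lambda>t. f j t * (\<Prod>i\<in>I. f i t))
      (\<lambda>t. u j t * (\<Prod>i\<in>I. f i t) + f j t * (\<Sum>i\<in>I. u i t * (\<Prod>k\<in>I-{i}. f k t)))"
    by (rule primitive_mult[OF insert.prems[OF insertI1] insert.IH]) (rule insert.prems[OF insertI2])
  then show ?case
  proof (rule primitive_cong)
    fix t
    have "f j t * (u i t * (\<Prod>k\<in>I-{i}. f k t)) = u i t * (\<Prod>k\<in>insert j I-{i}. f k t)" if "i \<in> I" for i
    proof -
      have "insert j I - {i} = insert j (I - {i})" "j \<notin> I - {i}"
        using insert.hyps that by auto
      then show ?thesis
        using \<open>finite I\<close> by (simp only: prod.insert finite_Diff simp_thms) (simp only: mult.left_commute)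
    qed
    then have "(\<Sum>i\<in>I. f j t * (u i t * (\<Prod>k\<in>I-{i}. f k t))) = (\<Sum>i\<in>I. u i t * (\<Prod>k\<in>insert j I-{i}. f k t))"
      by (rule sum.cong[OF refl])
    moreover have "insert j I - {j} = I"
      using insert.hyps by auto
    ultimately show "u j t * (\<Prod>i\<in>I. f i t) + f j t * (\<Sum>i\<in>I. u i t * (\<Prod>k\<in>I-{i}. f k t))
        = (\<Sum>i\<in>insert j I. u i t * (\<Prod>k\<in>insert j I-{i}. f k t))"
      by (simp only: sum.insert[OF insert.hyps] sum_distrib_left)
  qed (simp only: prod.insert[OF insert.hyps])
qed

lemma primitive_power:
  "primitive a f u \<Longrightarrow> primitive a (\<lambda>t. f t ^ Suc n) (\<lambda>t. real (Suc n) * (u t * f t ^ n))"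
proof (induction n)
  case (Suc n)
  show ?case
    by (rule primitive_cong[OF primitive_mult[OF Suc.prems Suc.IH[OF Suc.prems]]])
       (simp_all add: algebra_simps)
qed simp

lemma finite_family_uniformly_continuous:
  fixes f :: "'i \<Rightarrow> real \<Rightarrow> real"
  assumes "finite I" "\<And>i. i \<in> I \<Longrightarrow> continuous_on {a..b} (f i)" "e > 0"
  shows "\<exists>d>0. \<forall>i\<in>I. \<forall>x\<in>{a..b}. \<forall>y\<in>{a..b}. \<bar>y - x\<bar> < d \<longrightarrow> \<bar>f i y - f i x\<bar> < e"
  using assms(1,2)
proof (induction I rule: finite_induct)
  case empty
  then show ?case by (auto intro: exI[of _ 1])
next
  case (insert i I)
  then obtain d1 where d1: "d1 > 0"
    "\<forall>i\<in>I. \<forall>x\<in>{a..b}. \<forall>y\<in>{a..b}. \<bar>y - x\<bar> < d1 \<longrightarrow> \<bar>f i y - f i x\<bar> < e"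
    by auto
  have "uniformly_continuous_on {a..b} (f i)"
    using insert.prems by (intro compact_uniformly_continuous) auto
  then obtain d2 where d2: "d2 > 0"
    "\<forall>x\<in>{a..b}. \<forall>y\<in>{a..b}. \<bar>y - x\<bar> < d2 \<longrightarrow> \<bar>f i y - f i x\<bar> < e"
    using \<open>e > 0\<close> unfolding uniformly_continuous_on_def dist_real_def by metis
  show ?case
    using d1 d2 by (intro exI[of _ "min d1 d2"]) auto
qed

section \<open>A maximum principle\<close>

text \<open>Over a short interval the solution is close to an explicit Euler step, whose weights are
  non-negative and sum to at most 1, so the step cannot increase the maximum norm; the forcing adds
  at most the increment of \<open>R\<close>. Row sums are only bounded above by 0 so that the
  principle also covers the coefficients restricted to a proper subset of the nodes.\<close>

lemma max_principle:
  fixes x :: "'i \<Rightarrow> real \<Rightarrow> real"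
  assumes "finite I"
    and x: "\<And>i. i \<in> I \<Longrightarrow> primitive a (x i) (\<lambda>t. (\<Sum>j\<in>I. b i j t * x j t) + r i t)"
    and B: "\<And>i j. \<lbrakk>i \<in> I; j \<in> I\<rbrakk> \<Longrightarrow> primitive a (B i j) (b i j)"
    and R: "primitive a R \<rho>"
    and r: "\<And>i t. \<lbrakk>i \<in> I; a \<le> t\<rbrakk> \<Longrightarrow> \<bar>r i t\<bar> \<le> \<rho> t"
    and offdiag: "\<And>i j t. \<lbrakk>i \<in> I; j \<in> I; i \<noteq> j; a \<le> t\<rbrakk> \<Longrightarrow> 0 \<le> b i j t"
    and rowsum: "\<And>i t. \<lbrakk>i \<in> I; a \<le> t\<rbrakk> \<Longrightarrow> (\<Sum>j\<in>I. b i j t) \<le> 0"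
    and "a \<le> t" and init: "\<And>i. i \<in> I \<Longrightarrow> \<bar>x i a\<bar> \<le> c" and "i \<in> I"
  shows "\<bar>x i t\<bar> \<le> c + (R t - R a)"
proof -
  define m where "m t = Max ((\<lambda>i. \<bar>x i t\<bar>) ` I)" for t
  have fin: "finite ((\<lambda>i. \<bar>x i t\<bar>) ` I)" "(\<lambda>i. \<bar>x i t\<bar>) ` I \<noteq> {}" for t
    using \<open>finite I\<close> \<open>i \<in> I\<close> by auto
  have m_ge: "\<bar>x i t\<bar> \<le> m t" if "i \<in> I" for i t
    unfolding m_def using fin that by (intro Max_ge) auto
  have m_nonneg: "0 \<le> m t" for t
    using m_ge[OF \<open>i \<in> I\<close>, of t] by linarith
  \<comment> \<open>The integral \<open>M\<close> of \<beta> is the function relative to whose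
    increments the errors of the Euler steps are small.\<close>
  define \<beta> where "\<beta> t = (\<Sum>i\<in>I. \<Sum>j\<in>I. \<bar>b i j t\<bar>)" for t
  define M where "M t = integral {a..t} \<beta>" for t
  have M: "primitive a M \<beta>"
  proof -
    have "primitive a (\<lambda>t. integral {a..t} (\<lambda>t. \<bar>b i j t\<bar>)) (\<lambda>t. \<bar>b i j t\<bar>)" if "i \<in> I" "j \<in> I" for i j
      using that by (intro primitive_integral set_integrable_abs primitive_abs_integrable[OF B]) auto
    then have "primitive a (\<lambda>t. \<Sum>i\<in>I. \<Sum>j\<in>I. integral {a..t} (\<lambda>t. \<bar>b i j t\<bar>)) \<beta>"
      unfolding \<beta>_def by (intro primitive_sum) auto
    then show ?thesis
      unfolding M_def by (intro primitive_integral primitive_abs_integrable) auto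
  qed
  have "m t - R t \<le> m a - R a"
  proof (rule le_if_local_increment_le[OF \<open>a \<le> t\<close>, where m=M and K="\<lambda>t. m t - R t"])
    fix e :: real assume "e > 0"
    have "\<exists>d>0. \<forall>i\<in>I. \<forall>p\<in>{a..t}. \<forall>q\<in>{a..t}. \<bar>q - p\<bar> < d \<longrightarrow> \<bar>x i q - x i p\<bar> < e"
      by (rule finite_family_uniformly_continuous[OF \<open>finite I\<close> primitive_continuous[OF x] \<open>e > 0\<close>])
    then obtain d1 where d1: "d1 > 0"
      "\<And>i p q. \<lbrakk>i \<in> I; p \<in> {a..t}; q \<in> {a..t}; \<bar>q - p\<bar> < d1\<rbrakk> \<Longrightarrow> \<bar>x i q - x i p\<bar> < e"
      by blast
    \<comment> \<open>A change of \<open>B i i\<close> by less than 1 keeps the diagonal weight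
      \<open>1 + ?D i\<close> of the Euler step non-negative.\<close>
    have "\<exists>d>0. \<forall>i\<in>I. \<forall>p\<in>{a..t}. \<forall>q\<in>{a..t}. \<bar>q - p\<bar> < d \<longrightarrow> \<bar>B i i q - B i i p\<bar> < 1"
      by (rule finite_family_uniformly_continuous[OF \<open>finite I\<close> primitive_continuous[OF B]]) auto
    then obtain d2 where d2: "d2 > 0"
      "\<And>i p q. \<lbrakk>i \<in> I; p \<in> {a..t}; q \<in> {a..t}; \<bar>q - p\<bar> < d2\<rbrakk> \<Longrightarrow> \<bar>B i i q - B i i p\<bar> < 1"
      by blast
    show "\<exists>d>0. \<forall>p q. a \<le> p \<longrightarrow> p \<le> q \<longrightarrow> q \<le> t \<longrightarrow> q - p < d \<longrightarrow>
            (m q - R q) - (m p - R p) \<le> e * (M q - M p)"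
    proof (intro exI[of _ "min d1 d2"] conjI allI impI)
      fix p q assume pq: "a \<le> p" "p \<le> q" "q \<le> t" "q - p < min d1 d2"
      have "\<bar>x i q\<bar> \<le> m p + e * (M q - M p) + (R q - R p)" if i: "i \<in> I" for i
      proof -
        let ?D = "\<lambda>j. B i j q - B i j p"
        \<comment> \<open>Subtracting the equation with \<open>x\<close> frozen at time
          \<open>p\<close> leaves the forcing and an error bounded by
          \<open>e * \<beta> s\<close>.\<close>
        have 1: "((\<lambda>s. ((\<Sum>j\<in>I. b i j s * x j s) + r i s) - (\<Sum>j\<in>I. x j p * b i j s)) has_integral
                    (x i q - x i p) - (\<Sum>j\<in>I. x j p * ?D j)) {p..q}"
          using i pq \<open>finite I\<close>
          by (intro has_integral_diff primitive_increment[OF x] has_integral_sum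
                has_integral_mult_right primitive_increment[OF B]) auto
        have 2: "((\<lambda>s. e * \<beta> s + \<rho> s) has_integral e * (M q - M p) + (R q - R p)) {p..q}"
          using pq by (intro has_integral_add has_integral_mult_right primitive_increment[OF M] primitive_increment[OF R])
        have le: "\<bar>((\<Sum>j\<in>I. b i j s * x j s) + r i s) - (\<Sum>j\<in>I. x j p * b i j s)\<bar> \<le> e * \<beta> s + \<rho> s"
          if s: "s \<in> {p..q}" for s
        proof -
          have "((\<Sum>j\<in>I. b i j s * x j s) + r i s) - (\<Sum>j\<in>I. x j p * b i j s)
                  = (\<Sum>j\<in>I. b i j s * (x j s - x j p)) + r i s"
            by (simp add: right_diff_distrib sum_subtractf mult.commute)
          also have "\<bar>\<dots>\<bar> \<le> (\<Sum>j\<in>I. \<bar>b i j s * (x j s - x j p)\<bar>) + \<rho> s"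
            using i s pq by (intro order_trans[OF abs_triangle_ineq] add_mono sum_abs r) auto
          also have "(\<Sum>j\<in>I. \<bar>b i j s * (x j s - x j p)\<bar>) \<le> (\<Sum>j\<in>I. e * \<bar>b i j s\<bar>)"
          proof (rule sum_mono)
            fix j assume "j \<in> I"
            have "\<bar>x j s - x j p\<bar> \<le> e"
              using s pq d1(2)[OF \<open>j \<in> I\<close>, of p s] by auto
            then have "\<bar>b i j s\<bar> * \<bar>x j s - x j p\<bar> \<le> \<bar>b i j s\<bar> * e"
              by (rule mult_left_mono) simp
            then show "\<bar>b i j s * (x j s - x j p)\<bar> \<le> e * \<bar>b i j s\<bar>"
              by (simp add: abs_mult mult.commute)
          qed
          also have "(\<Sum>j\<in>I. e * \<bar>b i j s\<bar>) \<le> e * \<beta> s"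
            unfolding \<beta>_def sum_distrib_left[symmetric]
            using \<open>e > 0\<close> i \<open>finite I\<close>
            by (intro mult_left_mono member_le_sum[where f="\<lambda>i. \<Sum>j\<in>I. \<bar>b i j s\<bar>"]) (auto intro: sum_nonneg)
          finally show ?thesis by simp
        qed
        have "norm (integral {p..q} (\<lambda>s. ((\<Sum>j\<in>I. b i j s * x j s) + r i s) - (\<Sum>j\<in>I. x j p * b i j s)))
               \<le> integral {p..q} (\<lambda>s. e * \<beta> s + \<rho> s)"
          using le by (intro integral_norm_bound_integral has_integral_integrable[OF 1] has_integral_integrable[OF 2]) auto
        then have A: "\<bar>(x i q - x i p) - (\<Sum>j\<in>I. x j p * ?D j)\<bar> \<le> e * (M q - M p) + (R q - R p)"
          unfolding integral_unique[OF 1] integral_unique[OF 2] by simp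
        have D_off: "0 \<le> ?D j" if "j \<in> I" "i \<noteq> j" for j
          using has_integral_nonneg[OF primitive_increment[OF B[OF i \<open>j \<in> I\<close>] pq(1,2)]] offdiag[OF i that] pq
          by auto
        have D_diag: "-1 \<le> ?D i"
          using d2(2)[of i p q] i pq by auto
        have D_sum: "(\<Sum>j\<in>I. ?D j) \<le> 0"
        proof (rule has_integral_le)
          show "((\<lambda>s. \<Sum>j\<in>I. b i j s) has_integral (\<Sum>j\<in>I. ?D j)) {p..q}"
            using i pq \<open>finite I\<close> by (intro has_integral_sum primitive_increment[OF B]) auto
          show "((\<lambda>_. 0) has_integral (0::real)) {p..q}" by simp
        qed (use rowsum[OF i] pq in auto)
        have split: "(\<Sum>j\<in>I. f j) = f i + (\<Sum>j\<in>I-{i}. f j)" for f :: "'i \<Rightarrow> real"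
          using i \<open>finite I\<close> by (rule sum.remove[rotated])
        \<comment> \<open>The Euler step weights \<open>x i p\<close> with \<open>1 + ?D i\<close>
          and every other \<open>x j p\<close> with \<open>?D j\<close>; all weights are
          non-negative and their total is at most 1.\<close>
        have "\<bar>x i p + (\<Sum>j\<in>I. x j p * ?D j)\<bar> = \<bar>x i p * (1 + ?D i) + (\<Sum>j\<in>I-{i}. x j p * ?D j)\<bar>"
          by (subst split) (simp add: algebra_simps)
        also have "\<dots> \<le> \<bar>x i p\<bar> * (1 + ?D i) + (\<Sum>j\<in>I-{i}. \<bar>x j p * ?D j\<bar>)"
          using D_diag by (intro order_trans[OF abs_triangle_ineq] add_mono sum_abs) (simp add: abs_mult)
        also have "\<dots> \<le> m p * (1 + ?D i) + (\<Sum>j\<in>I-{i}. m p * ?D j)"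
        proof (intro add_mono sum_mono mult_right_mono)
          fix j assume "j \<in> I - {i}"
          then show "\<bar>x j p * ?D j\<bar> \<le> m p * ?D j"
            using D_off[of j] m_ge[of j p] by (auto simp: abs_mult intro!: mult_right_mono)
        qed (use m_ge i D_diag in auto)
        also have "\<dots> = m p + m p * (\<Sum>j\<in>I. ?D j)"
          by (subst split) (simp add: algebra_simps sum_distrib_left)
        also have "\<dots> \<le> m p"
          using mult_nonneg_nonpos[OF m_nonneg[of p] D_sum] by simp
        finally show ?thesis using A by linarith
      qed
      then have "m q \<le> m p + e * (M q - M p) + (R q - R p)"
        unfolding m_def[of q] using fin by (intro Max.boundedI) auto
      then show "(m q - R q) - (m p - R p) \<le> e * (M q - M p)" by simp
    qed (use d1(1) d2(1) in auto)
  qed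
  moreover have "m a \<le> c"
    unfolding m_def using fin init by (intro Max.boundedI) auto
  ultimately show ?thesis
    using m_ge[OF \<open>i \<in> I\<close>, of t] by linarith
qed

section \<open>Solutions and the transition matrix\<close>

lemma primitive_continuous_atLeast:
  assumes "primitive a f u"
  shows "continuous_on {a..} f"
  unfolding continuous_on_eq_continuous_within
proof
  fix x assume "x \<in> {a..}"
  have "continuous (at x within {a..x+1}) f"
    using primitive_continuous[OF assms, of "x+1"] \<open>x \<in> {a..}\<close>
    by (simp add: continuous_on_eq_continuous_within)
  moreover have "at x within {a..} = at x within {a..x+1}"
    by (rule at_within_nhd[of x "{..<x+1}"]) auto
  ultimately show "continuous (at x within {a..}) f" by simp
qed

lemma has_integral_vec_iff:
  fixes f :: "'a::euclidean_space \<Rightarrow> real^'n"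
  shows "(f has_integral y) S \<longleftrightarrow> (\<forall>i. ((\<lambda>x. f x $ i) has_integral (y $ i)) S)"
  by (subst has_integral_componentwise_iff) (auto simp: Basis_vec_def inner_axis)

section \<open>Solutions as families of primitives, with uniqueness and existence\<close>

lemma chain_abs_integrable:
  assumes "ct_chain A" "0 \<le> \<tau>"
  shows "(\<lambda>t. A t $ i $ j) absolutely_integrable_on {\<tau>..t}"
proof (rule abs_integrable_subinterval[where a=0 and b="max 0 t"])
  show "(\<lambda>t. A t $ i $ j) absolutely_integrable_on {0..max 0 t}"
    using assms unfolding ct_chain_def by (meson max.cobounded1)
qed (use assms in auto)

lemma chain_primitive:
  assumes "ct_chain A" "0 \<le> \<tau>"
  shows "primitive \<tau> (\<lambda>t. integral {\<tau>..t} (\<lambda>s. A s $ i $ j)) (\<lambda>t. A t $ i $ j)"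
  by (intro primitive_integral chain_abs_integrable assms)

text \<open>This gives access to the calculus of primitives. The absolute integrability hidden in
  \<open>primitive\<close> is not part of \<open>is_solution\<close>; it holds because each summand
  is an absolutely integrable coefficient times a continuous function.\<close>

lemma is_solution_iff:
  assumes A: "ct_chain A" and \<tau>: "0 \<le> \<tau>"
  shows "is_solution A \<tau> x \<longleftrightarrow>
     (\<forall>i. primitive \<tau> (\<lambda>t. x t $ i) (\<lambda>t. \<Sum>j\<in>UNIV. A t $ i $ j * x t $ j))"
    (is "?L \<longleftrightarrow> ?R")
proof
  assume ?L
  show ?R
  proof (intro allI primitiveI)
    fix i t assume "\<tau> \<le> t"
    have "continuous_on {\<tau>..t} (\<lambda>t. x t $ j)" for j
      using \<open>?L\<close> unfolding is_solution_def
      by (intro continuous_intros) (meson atLeastAtMost_iff atLeast_iff continuous_on_subset subsetI)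
    then show "(\<lambda>t. \<Sum>j\<in>UNIV. A t $ i $ j * x t $ j) absolutely_integrable_on {\<tau>..t}"
      using abs_integrable_continuous_mult[OF _ chain_abs_integrable[OF A \<tau>]]
      by (intro absolutely_integrable_sum) (auto simp: mult.commute)
    show "((\<lambda>t. \<Sum>j\<in>UNIV. A t $ i $ j * x t $ j) has_integral x t $ i - x \<tau> $ i) {\<tau>..t}"
      using \<open>?L\<close> \<open>\<tau> \<le> t\<close> by (auto simp: is_solution_def has_integral_vec_iff matrix_vector_mult_def)
  qed
next
  assume ?R
  then have "continuous_on {\<tau>..} (\<lambda>t. \<chi> i. x t $ i)"
    by (intro continuous_on_vec_lambda) (use primitive_continuous_atLeast in blast)
  moreover have "((\<lambda>s. A s *v x s) has_integral (x t - x \<tau>)) {\<tau>..t}" if "\<tau> \<le> t" for t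
    using \<open>?R\<close> that by (auto simp: primitive_def has_integral_vec_iff matrix_vector_mult_def)
  ultimately show ?L
    by (simp add: is_solution_def)
qed

text \<open>The maximum principle on all nodes without forcing. It yields both the uniqueness of
  solutions and the boundedness of the transition matrices.\<close>

lemma solution_abs_le:
  assumes A: "ct_chain A" and "0 \<le> \<tau>" "is_solution A \<tau> x" "\<tau> \<le> t"
    and init: "\<And>j. \<bar>x \<tau> $ j\<bar> \<le> c"
  shows "\<bar>x t $ i\<bar> \<le> c"
proof -
  have "\<bar>x t $ i\<bar> \<le> c + ((\<lambda>_. 0) t - (\<lambda>_. 0) \<tau>)"
  proof (rule max_principle[where I=UNIV and r="\<lambda>_ _. 0" and \<rho>="\<lambda>_. 0" and x="\<lambda>i t. x t $ i"])
    show "primitive \<tau> (\<lambda>t. x t $ i) (\<lambda>t. (\<Sum>j\<in>UNIV. A t $ i $ j * x t $ j) + 0)" for i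
      using \<open>is_solution A \<tau> x\<close> unfolding is_solution_iff[OF A \<open>0 \<le> \<tau>\<close>] by simp
  qed (use assms in \<open>auto intro: chain_primitive primitive_const simp: ct_chain_def\<close>)
  then show ?thesis by simp
qed

lemma is_solution_restrict:
  assumes "ct_chain A" "0 \<le> \<tau>" "\<tau> \<le> \<sigma>" "is_solution A \<tau> x"
  shows "is_solution A \<sigma> x"
  using assms by (simp add: is_solution_iff) (blast intro: primitive_restrict)

text \<open>Stated for indexed sums so that it serves both for differences of two solutions and for
  expansions in the unit vectors.\<close>

lemma is_solution_combination:
  assumes A: "ct_chain A" and \<tau>: "0 \<le> \<tau>"
    and "\<And>k. is_solution A \<tau> (X k)"
  shows "is_solution A \<tau> (\<lambda>t. \<Sum>k\<in>K. c k *\<^sub>R X k t)"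
  unfolding is_solution_iff[OF A \<tau>]
proof
  fix i
  have "primitive \<tau> (\<lambda>t. \<Sum>k\<in>K. c k * X k t $ i) (\<lambda>t. \<Sum>k\<in>K. c k * (\<Sum>j\<in>UNIV. A t $ i $ j * X k t $ j))"
    using assms by (intro primitive_sum primitive_cmult) (simp add: is_solution_iff)
  then show "primitive \<tau> (\<lambda>t. (\<Sum>k\<in>K. c k *\<^sub>R X k t) $ i)
               (\<lambda>t. \<Sum>j\<in>UNIV. A t $ i $ j * (\<Sum>k\<in>K. c k *\<^sub>R X k t) $ j)"
  proof (rule primitive_cong)
    fix t
    have "(\<Sum>k\<in>K. c k * (\<Sum>j\<in>UNIV. A t $ i $ j * X k t $ j)) = (\<Sum>k\<in>K. \<Sum>j\<in>UNIV. A t $ i $ j * (c k * X k t $ j))"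
      by (simp add: sum_distrib_left mult.left_commute)
    also have "\<dots> = (\<Sum>j\<in>UNIV. A t $ i $ j * (\<Sum>k\<in>K. c k *\<^sub>R X k t) $ j)"
      by (subst sum.swap) (simp add: sum_distrib_left)
    finally show "(\<Sum>k\<in>K. c k * (\<Sum>j\<in>UNIV. A t $ i $ j * X k t $ j))
        = (\<Sum>j\<in>UNIV. A t $ i $ j * (\<Sum>k\<in>K. c k *\<^sub>R X k t) $ j)" .
  qed simp
qed

lemma is_solution_unique:
  assumes A: "ct_chain A" and \<tau>: "0 \<le> \<tau>" "\<tau> \<le> t"
    and x: "is_solution A \<tau> x" and y: "is_solution A \<tau> y" and "x \<tau> = y \<tau>"
  shows "x t = y t"
proof -
  \<comment> \<open>The difference is written as a linear combination indexed by the two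
    Booleans.\<close>
  have "is_solution A \<tau> (\<lambda>t. \<Sum>k\<in>{True, False}. (if k then 1 else -1) *\<^sub>R (if k then x else y) t)"
    using x y by (intro is_solution_combination[OF A \<tau>(1)]) auto
  then have "is_solution A \<tau> (\<lambda>t. x t - y t)" by simp
  from solution_abs_le[OF A \<tau>(1) this \<tau>(2), of 0] have "\<bar>(x t - y t) $ i\<bar> \<le> 0" for i
    using \<open>x \<tau> = y \<tau>\<close> by auto
  then show ?thesis by (auto simp: vec_eq_iff)
qed

text \<open>The terms of the Peano--Baker series applied to the initial vector. The \<open>n\<close>-th one
  is bounded by \<open>c F(t)\<^sup>n / n!\<close> with \<open>F\<close> the integral of the sum of the absolute values of the coefficients.\<close>

primrec peano_baker :: "(real \<Rightarrow> real^'n^'n) \<Rightarrow> real \<Rightarrow> real^'n \<Rightarrow> nat \<Rightarrow> 'n \<Rightarrow> real \<Rightarrow> real" where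
  "peano_baker A \<tau> v 0 i t = v $ i"
| "peano_baker A \<tau> v (Suc n) i t =
     integral {\<tau>..t} (\<lambda>s. \<Sum>j\<in>UNIV. A s $ i $ j * peano_baker A \<tau> v n j s)"

text \<open>The exponential series of \<open>F t\<close> majorizes the Peano-Baker series, which
  therefore converges uniformly on \<open>{\<tau>..t}\<close> to a continuous limit. The integral
  equation passes from the partial sums to the limit by dominated convergence.\<close>

lemma ex_solution:
  fixes v :: "real^'n"
  assumes A: "ct_chain A" and \<tau>: "0 \<le> \<tau>"
  shows "\<exists>x. is_solution A \<tau> x \<and> x \<tau> = v"
proof -
  define I where "I = peano_baker A \<tau> v"
  have I0: "I 0 i t = v $ i" and
    ISuc: "I (Suc n) i t = integral {\<tau>..t} (\<lambda>s. \<Sum>j\<in>UNIV. A s $ i $ j * I n j s)" for n i t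
    by (simp_all add: I_def)
  have comb: "(\<lambda>s. \<Sum>j\<in>UNIV. A s $ i $ j * y j s) absolutely_integrable_on {\<tau>..t}"
    if "\<And>j. continuous_on {\<tau>..t} (y j)" for i t and y :: "'n \<Rightarrow> real \<Rightarrow> real"
    using abs_integrable_continuous_mult[OF that chain_abs_integrable[OF A \<tau>]]
    by (intro absolutely_integrable_sum) (auto simp: mult.commute)
  have I_cont: "continuous_on {\<tau>..t} (I n i)" for n i t
  proof (induction n arbitrary: i t)
    case 0
    then show ?case by (simp add: I0[abs_def] cong: continuous_on_cong)
  next
    case (Suc n)
    have "I (Suc n) i = (\<lambda>t. integral {\<tau>..t} (\<lambda>s. \<Sum>j\<in>UNIV. A s $ i $ j * I n j s))"
      by (simp add: fun_eq_iff ISuc)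
    then show ?case
      using primitive_continuous[OF primitive_integral[OF comb[OF Suc.IH]]] by simp
  qed
  have I_prim: "primitive \<tau> (I (Suc n) i) (\<lambda>s. \<Sum>j\<in>UNIV. A s $ i $ j * I n j s)" for n i
  proof -
    have "I (Suc n) i = (\<lambda>t. integral {\<tau>..t} (\<lambda>s. \<Sum>j\<in>UNIV. A s $ i $ j * I n j s))"
      by (simp add: fun_eq_iff ISuc)
    then show ?thesis
      using primitive_integral[OF comb[OF I_cont]] by simp
  qed
  define \<alpha> where "\<alpha> t = (\<Sum>i\<in>UNIV. \<Sum>j\<in>UNIV. \<bar>A t $ i $ j\<bar>)" for t
  have \<alpha>_nonneg: "0 \<le> \<alpha> t" for t
    by (simp add: \<alpha>_def sum_nonneg)
  define F where "F t = integral {\<tau>..t} \<alpha>" for t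
  have "\<alpha> absolutely_integrable_on {\<tau>..t}" for t
    unfolding \<alpha>_def
    by (intro absolutely_integrable_sum set_integrable_abs chain_abs_integrable[OF A \<tau>]) auto
  then have F: "primitive \<tau> F \<alpha>"
    unfolding F_def by (rule primitive_integral)
  have F\<tau>: "F \<tau> = 0" by (simp add: F_def)
  have F_nonneg: "0 \<le> F t" if "\<tau> \<le> t" for t
    using has_integral_nonneg[OF primitive_increment[OF F order_refl that]] \<alpha>_nonneg F\<tau> by auto
  have F_mono: "F s \<le> F t" if "\<tau> \<le> s" "s \<le> t" for s t
    using has_integral_nonneg[OF primitive_increment[OF F that]] \<alpha>_nonneg by auto
  define c where "c = norm v"
  have "0 \<le> c" by (simp add: c_def)
  have row: "\<bar>\<Sum>j\<in>UNIV. A t $ i $ j * y j\<bar> \<le> \<alpha> t * d" if "\<And>j. \<bar>y j\<bar> \<le> d" for t i d and y :: "'n \<Rightarrow> real"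
  proof -
    have "0 \<le> d" using that[of undefined] by linarith
    have "\<bar>\<Sum>j\<in>UNIV. A t $ i $ j * y j\<bar> \<le> (\<Sum>j\<in>UNIV. \<bar>A t $ i $ j\<bar> * d)"
      by (intro order_trans[OF sum_abs] sum_mono) (simp add: abs_mult that mult_left_mono)
    also have "\<dots> = (\<Sum>j\<in>UNIV. \<bar>A t $ i $ j\<bar>) * d"
      by (simp add: sum_distrib_right)
    also have "\<dots> \<le> \<alpha> t * d"
      unfolding \<alpha>_def using \<open>0 \<le> d\<close>
      by (intro mult_right_mono member_le_sum[where f="\<lambda>i. \<Sum>j\<in>UNIV. \<bar>A t $ i $ j\<bar>"]) (auto intro: sum_nonneg)
    finally show ?thesis .
  qed
  have I_bound: "\<bar>I n i t\<bar> \<le> c * (F t ^ n / fact n)" if "\<tau> \<le> t" for n i t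
    using that
  proof (induction n arbitrary: i t)
    case 0
    then show ?case by (simp add: I0 c_def component_le_norm_cart)
  next
    case (Suc n)
    \<comment> \<open>The claimed bound has exactly \<alpha> times the previous bound as its
      derivative, so the induction step is an integration without loss.\<close>
    have "primitive \<tau> (\<lambda>t. c / fact (Suc n) * F t ^ Suc n) (\<lambda>t. c / fact (Suc n) * (real (Suc n) * (\<alpha> t * F t ^ n)))"
      by (intro primitive_cmult primitive_power F)
    then have 1: "((\<lambda>s. c / fact (Suc n) * (real (Suc n) * (\<alpha> s * F s ^ n))) has_integral
                c / fact (Suc n) * F t ^ Suc n - c / fact (Suc n) * F \<tau> ^ Suc n) {\<tau>..t}"
      using Suc.prems by (rule primitive_increment[OF _ order_refl])
    have "norm (I (Suc n) i t) \<le> integral {\<tau>..t} (\<lambda>s. c / fact (Suc n) * (real (Suc n) * (\<alpha> s * F s ^ n)))"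
      unfolding ISuc
    proof (rule integral_norm_bound_integral[OF primitive_integrable[OF I_prim order_refl] has_integral_integrable[OF 1]])
      fix s assume "s \<in> {\<tau>..t}"
      then have "\<bar>\<Sum>j\<in>UNIV. A s $ i $ j * I n j s\<bar> \<le> \<alpha> s * (c * (F s ^ n / fact n))"
        by (intro row Suc.IH) auto
      also have "\<dots> = c / fact (Suc n) * (real (Suc n) * (\<alpha> s * F s ^ n))"
        by (simp add: field_simps del: of_nat_Suc)
      finally show "norm (\<Sum>j\<in>UNIV. A s $ i $ j * I n j s) \<le> \<dots>" by simp
    qed
    also have "\<dots> = c * (F t ^ Suc n / fact (Suc n))"
      unfolding integral_unique[OF 1] by (simp add: F\<tau>)
    finally show ?case by simp
  qed
  have I_bound': "\<bar>I n i s\<bar> \<le> c * (F t ^ n / fact n)" if "\<tau> \<le> s" "s \<le> t" for n i s t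
    using that F_mono[OF that] F_nonneg[OF that(1)] \<open>0 \<le> c\<close>
    by (intro order_trans[OF I_bound[OF that(1)]] mult_left_mono divide_right_mono power_mono) auto
  have exp_sums: "(\<lambda>n. c * (F t ^ n / fact n)) sums (c * exp (F t))" for t
    using sums_mult[OF exp_converges[of "F t"], of c] by (simp add: divide_inverse_commute)
  define S where "S i t = (\<Sum>n. I n i t)" for i t
  have unif: "uniform_limit {\<tau>..t} (\<lambda>N s. \<Sum>n<N. I n i s) (S i) sequentially" for i t
    unfolding S_def
    by (rule Weierstrass_m_test[OF _ sums_summable[OF exp_sums[of t]]]) (use I_bound' in auto)
  have S_cont: "continuous_on {\<tau>..t} (S i)" for i t
    by (rule uniform_limit_theorem[OF _ unif]) (auto intro!: always_eventually continuous_on_sum I_cont)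
  have S_lim: "(\<lambda>N. \<Sum>n<N. I n i s) \<longlonglongrightarrow> S i s" if "\<tau> \<le> s" for i s
    using tendsto_uniform_limitI[OF unif, of s s] that by auto
  have P_bound: "\<bar>\<Sum>n<N. I n i s\<bar> \<le> c * exp (F t)" if "\<tau> \<le> s" "s \<le> t" for N i s t
  proof -
    have "\<bar>\<Sum>n<N. I n i s\<bar> \<le> (\<Sum>n<N. c * (F t ^ n / fact n))"
      using I_bound' that by (intro order_trans[OF sum_abs] sum_mono) auto
    also have "\<dots> \<le> (\<Sum>n. c * (F t ^ n / fact n))"
      using F_nonneg[of t] that \<open>0 \<le> c\<close> by (intro sum_le_suminf sums_summable[OF exp_sums[of t]]) auto
    also have "\<dots> = c * exp (F t)"
      using exp_sums sums_unique by metis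
    finally show ?thesis .
  qed
  have S_int: "((\<lambda>s. \<Sum>j\<in>UNIV. A s $ i $ j * S j s) has_integral S i t - v $ i) {\<tau>..t}" if "\<tau> \<le> t" for i t
  proof -
    let ?f = "\<lambda>N s. \<Sum>j\<in>UNIV. A s $ i $ j * (\<Sum>n<N. I n j s)" and ?g = "\<lambda>s. \<Sum>j\<in>UNIV. A s $ i $ j * S j s"
    \<comment> \<open>Integrating the terms below \<open>N\<close> produces the terms from 1 to
      \<open>N\<close>; this is the partial sum up to \<open>Suc N\<close> without its zeroth term
      \<open>v $ i\<close>.\<close>
    have f: "(?f N has_integral (\<Sum>n<Suc N. I n i t) - v $ i) {\<tau>..t}" for N
    proof -
      have "((\<lambda>s. \<Sum>n<N. \<Sum>j\<in>UNIV. A s $ i $ j * I n j s) has_integral (\<Sum>n<N. I (Suc n) i t - I (Suc n) i \<tau>)) {\<tau>..t}"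
        using that by (intro has_integral_sum primitive_increment[OF I_prim]) auto
      moreover have "(\<Sum>n<N. \<Sum>j\<in>UNIV. A s $ i $ j * I n j s) = ?f N s" for s
        by (subst sum.swap) (simp add: sum_distrib_left)
      moreover have "(\<Sum>n<N. I (Suc n) i t - I (Suc n) i \<tau>) = (\<Sum>n<Suc N. I n i t) - v $ i"
        by (simp add: sum.lessThan_Suc_shift I0 ISuc del: sum.lessThan_Suc)
      ultimately show ?thesis by simp
    qed
    have dom: "?g integrable_on {\<tau>..t}" "(\<lambda>N. integral {\<tau>..t} (?f N)) \<longlonglongrightarrow> integral {\<tau>..t} ?g"
    proof -
      note dc = dominated_convergence[where f="?f" and g="?g" and h="\<lambda>s. \<alpha> s * (c * exp (F t))" and S="{\<tau>..t}"]
      have 1: "?f N integrable_on {\<tau>..t}" for N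
        using f[of N] by (rule has_integral_integrable)
      have 2: "(\<lambda>s. \<alpha> s * (c * exp (F t))) integrable_on {\<tau>..t}"
        using primitive_integrable[OF F order_refl] by (rule integrable_on_mult_left)
      have 3: "norm (?f N s) \<le> \<alpha> s * (c * exp (F t))" if "s \<in> {\<tau>..t}" for N s
        unfolding real_norm_def by (rule row[OF P_bound]) (use that in auto)
      have 4: "(\<lambda>N. ?f N s) \<longlonglongrightarrow> ?g s" if "s \<in> {\<tau>..t}" for s
        by (rule tendsto_sum[OF tendsto_mult[OF tendsto_const S_lim]]) (use that in auto)
      show "?g integrable_on {\<tau>..t}" "(\<lambda>N. integral {\<tau>..t} (?f N)) \<longlonglongrightarrow> integral {\<tau>..t} ?g"
        using dc[OF 1 2 3 4] by simp_all
    qed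
    have "(\<lambda>N. integral {\<tau>..t} (?f N)) \<longlonglongrightarrow> S i t - v $ i"
      unfolding integral_unique[OF f]
      by (intro tendsto_diff tendsto_const LIMSEQ_Suc S_lim that)
    then have "integral {\<tau>..t} ?g = S i t - v $ i"
      using dom(2) LIMSEQ_unique by blast
    then show ?thesis
      using integrable_integral[OF dom(1)] by simp
  qed
  \<comment> \<open>Over the degenerate interval the integral is 0, so the integral equation itself
    yields the initial value.\<close>
  have S\<tau>: "S i \<tau> = v $ i" for i
    using has_integral_unique[OF S_int[of \<tau> i] has_integral_null_real] by simp
  have "is_solution A \<tau> (\<lambda>t. \<chi> i. S i t)"
    unfolding is_solution_iff[OF A \<tau>]
    by (intro allI primitiveI) (use comb S_cont S_int S\<tau> in auto)
  moreover have "(\<chi> i. S i \<tau>) = v"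
    by (simp add: S\<tau> vec_eq_iff)
  ultimately show ?thesis by blast
qed

text \<open>Discharges the definite description: the matrix whose columns are the solutions starting
  at the unit vectors has the required property by linearity and uniqueness, and any other candidate
  must have the same columns.\<close>

lemma state_transition_eq:
  fixes A :: "real \<Rightarrow> real^'n^'n"
  assumes A: "ct_chain A" and \<tau>: "0 \<le> \<tau>" "\<tau> \<le> t" and "is_solution A \<tau> x"
  shows "x t = state_transition A t \<tau> *v x \<tau>"
proof -
  obtain X where X: "\<And>k. is_solution A \<tau> (X k)" "\<And>k. X k \<tau> = axis k 1"
  proof -
    have "\<forall>k. \<exists>x. is_solution A \<tau> x \<and> x \<tau> = axis k 1"
      using ex_solution[OF A \<tau>(1)] by blast
    from choice[OF this] show ?thesis using that by blast
  qed
  have comb: "x t = (\<Sum>k\<in>UNIV. (x \<tau> $ k) *\<^sub>R X k t)" if x: "is_solution A \<tau> x" for x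
  proof (rule is_solution_unique[OF A \<tau> x])
    show "is_solution A \<tau> (\<lambda>t. \<Sum>k\<in>UNIV. (x \<tau> $ k) *\<^sub>R X k t)"
      by (rule is_solution_combination[OF A \<tau>(1) X(1)])
    show "x \<tau> = (\<Sum>k\<in>UNIV. (x \<tau> $ k) *\<^sub>R X k \<tau>)"
      by (simp add: X(2) vec_eq_iff axis_def if_distrib cong: if_cong)
  qed
  let ?M = "\<chi> i k. X k t $ i"
  have "\<forall>x. is_solution A \<tau> x \<longrightarrow> x t = ?M *v x \<tau>"
    by (auto simp: comb vec_eq_iff matrix_vector_mult_def mult.commute)
  moreover have "M = ?M" if M: "\<forall>x. is_solution A \<tau> x \<longrightarrow> x t = M *v x \<tau>" for M
  proof -
    have "M *v axis k 1 = X k t" for k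
      using M X[of k] by auto
    then have "column k M = X k t" for k
      by (simp add: matrix_vector_mul_component matrix_vector_mult_basis)
    then show ?thesis
      by (auto simp: column_def vec_eq_iff)
  qed
  ultimately have "\<forall>x. is_solution A \<tau> x \<longrightarrow> x t = state_transition A t \<tau> *v x \<tau>"
    unfolding state_transition_def
    by (rule theI[where P="\<lambda>M. \<forall>x. is_solution A \<tau> x \<longrightarrow> x t = M *v x \<tau>"])
  then show ?thesis
    using assms(4) by blast
qed

section \<open>Composition law and bounds for the transition matrix\<close>

lemma state_transition_self:
  assumes A: "ct_chain A" and \<tau>: "0 \<le> \<tau>"
  shows "state_transition A \<tau> \<tau> = mat 1"
proof -
  have "state_transition A \<tau> \<tau> *v v = mat 1 *v v" for v
  proof -
    obtain x where x: "is_solution A \<tau> x" "x \<tau> = v"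
      using ex_solution[OF A \<tau>] by blast
    show ?thesis
      using state_transition_eq[OF A \<tau> order_refl x(1)] x(2) by simp
  qed
  then show ?thesis by (simp add: matrix_eq)
qed

lemma is_solution_state_transition:
  assumes A: "ct_chain A" and \<tau>: "0 \<le> \<tau>"
  shows "is_solution A \<tau> (\<lambda>t. state_transition A t \<tau> *v v)"
proof -
  obtain x where x: "is_solution A \<tau> x" "x \<tau> = v"
    using ex_solution[OF A \<tau>] by blast
  have eq: "x t = state_transition A t \<tau> *v v" if "\<tau> \<le> t" for t
    using state_transition_eq[OF A \<tau> that x(1)] x(2) by simp
  show ?thesis
    unfolding is_solution_iff[OF A \<tau>]
  proof
    fix i
    have "primitive \<tau> (\<lambda>t. x t $ i) (\<lambda>t. \<Sum>j\<in>UNIV. A t $ i $ j * x t $ j)"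
      using x(1) unfolding is_solution_iff[OF A \<tau>] by simp
    then show "primitive \<tau> (\<lambda>t. (state_transition A t \<tau> *v v) $ i)
        (\<lambda>t. \<Sum>j\<in>UNIV. A t $ i $ j * (state_transition A t \<tau> *v v) $ j)"
      by (rule primitive_cong) (simp_all only: eq)
  qed
qed

text \<open>A solution started at \<tau> is also a solution when restarted at \<sigma> from its
  value there.\<close>

lemma state_transition_mult:
  assumes A: "ct_chain A" and "0 \<le> \<tau>" "\<tau> \<le> \<sigma>" "\<sigma> \<le> t"
  shows "state_transition A t \<sigma> ** state_transition A \<sigma> \<tau> = state_transition A t \<tau>"
proof -
  have "(state_transition A t \<sigma> ** state_transition A \<sigma> \<tau>) *v v = state_transition A t \<tau> *v v" for v
  proof -
    have "is_solution A \<sigma> (\<lambda>t. state_transition A t \<tau> *v v)"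
      using assms by (intro is_solution_restrict[of A \<tau> \<sigma>] is_solution_state_transition)
    with A have "state_transition A t \<tau> *v v = state_transition A t \<sigma> *v (state_transition A \<sigma> \<tau> *v v)"
      using assms by (intro state_transition_eq) auto
    then show ?thesis
      by (simp only: matrix_vector_mul_assoc)
  qed
  then show ?thesis by (simp add: matrix_eq)
qed

lemma matrix_vector_mult_axis: "(M *v axis j 1) $ i = (M::real^'n^'m) $ i $ j"
  by (simp add: matrix_vector_mult_basis column_def)

lemma state_transition_primitive:
  assumes A: "ct_chain A" and \<tau>: "0 \<le> \<tau>"
  shows "primitive \<tau> (\<lambda>t. state_transition A t \<tau> $ i $ j)
           (\<lambda>t. \<Sum>k\<in>UNIV. A t $ i $ k * state_transition A t \<tau> $ k $ j)"
  using is_solution_state_transition[OF A \<tau>, of "axis j 1"]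
  unfolding is_solution_iff[OF A \<tau>] matrix_vector_mult_axis by blast

lemma state_transition_mult_vec_abs_le:
  assumes A: "ct_chain A" and \<tau>: "0 \<le> \<tau>" "\<tau> \<le> t" and "\<And>j. \<bar>v $ j\<bar> \<le> c"
  shows "\<bar>(state_transition A t \<tau> *v v) $ i\<bar> \<le> c"
  using solution_abs_le[OF A \<tau>(1) is_solution_state_transition[OF A \<tau>(1)] \<tau>(2)] assms(4)
  by (simp add: state_transition_self[OF A \<tau>(1)])

text \<open>The maximum-norm bound applied to a unit vector. It later provides convergent
  subsequences and bounds on determinants.\<close>

lemma state_transition_entry_abs_le:
  assumes "ct_chain A" "0 \<le> \<tau>" "\<tau> \<le> t"
  shows "\<bar>state_transition A t \<tau> $ i $ j\<bar> \<le> 1"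
proof -
  have "\<bar>(state_transition A t \<tau> *v axis j 1) $ i\<bar> \<le> 1"
    by (rule state_transition_mult_vec_abs_le[OF assms]) (simp add: axis_def)
  then show ?thesis
    by (simp only: matrix_vector_mult_axis)
qed

section \<open>Integrals over the half-line\<close>

text \<open>The graph is defined by non-negative Lebesgue integrals over the half-line, whereas the
  estimates use gauge integrals over bounded intervals; monotone convergence along
  \<open>{0..real n}\<close> connects the two.\<close>

lemma nn_integral_eq_SUP_integral:
  fixes f :: "real \<Rightarrow> real"
  assumes nonneg: "\<And>t. 0 \<le> t \<Longrightarrow> 0 \<le> f t"
    and int: "\<And>t. f absolutely_integrable_on {0..t}"
  shows "(\<integral>\<^sup>+t\<in>{0..}. ennreal (f t) \<partial>lebesgue) = (SUP n. ennreal (integral {0..real n} f))"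
proof -
  let ?h = "\<lambda>n t. ennreal (f t) * indicator {0..real n} t"
  have int': "integral\<^sup>N lebesgue (?h n) = ennreal (integral {0..real n} f)" for n
    unfolding nn_integral_completion
  proof (rule nn_integral_has_integral_lebesgue')
    show "(f has_integral integral {0..real n} f) {0..real n}"
      using int set_lebesgue_integral_eq_integral(1) by (intro integrable_integral) blast
  qed (use nonneg in auto)
  have meas: "?h n \<in> borel_measurable lebesgue" for n
  proof -
    have "(\<lambda>t. ennreal (indicator {0..real n} t *\<^sub>R f t)) \<in> borel_measurable lebesgue"
      using int[of "real n"] unfolding set_integrable_def by measurable
    moreover have "ennreal (indicator {0..real n} t *\<^sub>R f t) = ?h n t" for t
      by (auto simp: indicator_def)
    ultimately show ?thesis by simp
  qed
  have "(SUP n. ?h n t) = ennreal (f t) * indicator {0..} t" for t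
  proof (cases "0 \<le> t")
    case True
    obtain m where "t \<le> real m" using real_arch_simple by blast
    then have "ennreal (f t) \<le> (SUP n. ?h n t)"
      using True by (intro SUP_upper2[of m]) auto
    moreover have "(SUP n. ?h n t) \<le> ennreal (f t)"
      by (intro SUP_least) (auto simp: indicator_def)
    ultimately show ?thesis using True by auto
  qed auto
  then have "(\<integral>\<^sup>+t\<in>{0..}. ennreal (f t) \<partial>lebesgue) = (\<integral>\<^sup>+t. (SUP n. ?h n t) \<partial>lebesgue)"
    by simp
  also have "\<dots> = (SUP n. integral\<^sup>N lebesgue (?h n))"
    by (rule nn_integral_monotone_convergence_SUP[OF _ meas])
       (auto simp: incseq_def le_fun_def indicator_def)
  finally show ?thesis by (simp only: int')
qed

lemma integral_primitive_diff:
  assumes "primitive a f u" "a \<le> s" "s \<le> t"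
  shows "integral {s..t} u = f t - f s"
  by (rule integral_unique[OF primitive_increment[OF assms]])

text \<open>The primitive \<open>G\<close> is monotone and bounded, so it comes within
  \<open>e\<close> of its supremum at some time \<open>T\<close>, and after \<open>T\<close> it can
  grow by at most \<open>e\<close>.\<close>

lemma eventually_integral_le_if_nn_integral_finite:
  fixes f :: "real \<Rightarrow> real"
  assumes nonneg: "\<And>t. 0 \<le> t \<Longrightarrow> 0 \<le> f t"
    and int: "\<And>t. f absolutely_integrable_on {0..t}"
    and fin: "(\<integral>\<^sup>+t\<in>{0..}. ennreal (f t) \<partial>lebesgue) \<noteq> \<infinity>" and "e > 0"
  shows "\<forall>\<^sub>F \<tau> in at_top. \<forall>t\<ge>\<tau>. integral {\<tau>..t} f \<le> e"
proof -
  define G where "G t = integral {0..t} f" for t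
  have G: "primitive 0 G f"
    unfolding G_def by (intro primitive_integral int)
  have mono: "G s \<le> G t" if "0 \<le> s" "s \<le> t" for s t
    using has_integral_nonneg[OF primitive_increment[OF G that]] nonneg that by auto
  have G_nonneg: "0 \<le> G t" if "0 \<le> t" for t
    using mono[OF order_refl that] by (simp add: G_def)
  obtain K where K: "(SUP n. ennreal (G (real n))) = ennreal K" "0 \<le> K"
    using fin nn_integral_eq_SUP_integral[OF nonneg int]
    by (cases "SUP n. ennreal (G (real n))" rule: ennreal_cases) (auto simp: G_def)
  have le_K: "G t \<le> K" if "0 \<le> t" for t
  proof -
    obtain n where n: "t \<le> real n" using real_arch_simple by blast
    have "ennreal (G (real n)) \<le> ennreal K"
      unfolding K(1)[symmetric] by (rule SUP_upper) simp
    then show ?thesis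
      using K(2) mono[OF that n] by (simp add: ennreal_le_iff)
  qed
  define S where "S = (SUP t\<in>{0..}. G t)"
  have bdd: "bdd_above (G ` {0..})"
    using le_K by (intro bdd_aboveI2[where M=K]) auto
  have "\<exists>T\<in>{0..}. S - e < G T"
    using \<open>e > 0\<close> bdd unfolding S_def by (subst less_cSUP_iff[symmetric]) auto
  then obtain T where T: "0 \<le> T" "S - e < G T" by auto
  have "integral {\<tau>..t} f \<le> e" if "T \<le> \<tau>" "\<tau> \<le> t" for \<tau> t
  proof -
    have "G t \<le> S"
      unfolding S_def using bdd that T by (intro cSUP_upper) auto
    then show ?thesis
      using integral_primitive_diff[OF G, of \<tau> t] mono[of T \<tau>] T that by simp
  qed
  then show ?thesis
    using eventually_at_top_linorder by blast
qed

text \<open>The stretch before \<tau> contributes only the finite amount \<open>G \<tau>\<close>; a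
  bound \<open>K\<close> on all integrals from \<tau> on would bound the whole integral by
  \<open>G \<tau> + K\<close>.\<close>

lemma integral_unbounded_if_nn_integral_infinite:
  fixes f :: "real \<Rightarrow> real"
  assumes nonneg: "\<And>t. 0 \<le> t \<Longrightarrow> 0 \<le> f t"
    and int: "\<And>t. f absolutely_integrable_on {0..t}"
    and inf: "(\<integral>\<^sup>+t\<in>{0..}. ennreal (f t) \<partial>lebesgue) = \<infinity>" and "0 \<le> \<tau>"
  shows "\<exists>t\<ge>\<tau>. K \<le> integral {\<tau>..t} f"
proof (rule ccontr)
  assume "\<not> (\<exists>t\<ge>\<tau>. K \<le> integral {\<tau>..t} f)"
  then have K: "integral {\<tau>..t} f < K" if "\<tau> \<le> t" for t
    using that by force
  define G where "G t = integral {0..t} f" for t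
  have G: "primitive 0 G f"
    unfolding G_def by (intro primitive_integral int)
  have mono: "G s \<le> G t" if "0 \<le> s" "s \<le> t" for s t
    using has_integral_nonneg[OF primitive_increment[OF G that]] nonneg that by auto
  have "G (real n) \<le> G \<tau> + K" for n
  proof -
    have "G (real n) \<le> G (max \<tau> (real n))" by (rule mono) auto
    moreover have "G (max \<tau> (real n)) - G \<tau> < K"
      using K[of "max \<tau> (real n)"] integral_primitive_diff[OF G \<open>0 \<le> \<tau>\<close>, of "max \<tau> (real n)"] by simp
    ultimately show ?thesis by linarith
  qed
  then have "(SUP n. ennreal (G (real n))) \<le> ennreal (G \<tau> + K)"
    by (intro SUP_least ennreal_leI)
  then show False
    using nn_integral_eq_SUP_integral[OF nonneg int] inf by (simp add: G_def top_unique)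
qed

text \<open>If \<open>z\<close> stayed above \<epsilon>, the damping would remove an unbounded
  amount while the gain is at most \<open>L * \<delta>\<close>, so \<open>z\<close> reaches
  \<epsilon> at some time. From then on the damping can be bounded by 0, and the gain lifts
  \<open>z\<close> by at most \<open>L * \<delta>\<close>.\<close>

lemma primitive_decay:
  assumes z: "primitive \<tau> z w" and P: "primitive \<tau> P \<alpha>" and G: "primitive \<tau> G \<gamma>"
    and w: "\<And>t. \<tau> \<le> t \<Longrightarrow> w t \<le> - (\<alpha> t * z t) + L * \<gamma> t"
    and nonneg: "\<And>t. \<tau> \<le> t \<Longrightarrow> 0 \<le> \<alpha> t" "\<And>t. \<tau> \<le> t \<Longrightarrow> 0 \<le> \<gamma> t" "\<And>t. \<tau> \<le> t \<Longrightarrow> 0 \<le> z t" "0 \<le> L"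
    and unbounded: "\<And>K. \<exists>t\<ge>\<tau>. K \<le> P t - P \<tau>"
    and small: "\<And>t. \<tau> \<le> t \<Longrightarrow> G t - G \<tau> \<le> \<delta>" and "\<epsilon> > 0"
  shows "\<forall>\<^sub>F t in at_top. z t \<le> \<epsilon> + L * \<delta>"
proof -
  have "\<exists>s\<ge>\<tau>. z s \<le> \<epsilon>"
  proof (rule ccontr)
    assume "\<not> (\<exists>s\<ge>\<tau>. z s \<le> \<epsilon>)"
    then have big: "\<epsilon> < z s" if "\<tau> \<le> s" for s
      using that by force
    \<comment> \<open>At this time the loss, at rate at least \<open>\<epsilon> * \<alpha>\<close>,
      has consumed the initial value and all of the possible gain.\<close>
    obtain t where t: "\<tau> \<le> t" "(z \<tau> + L * \<delta>) / \<epsilon> \<le> P t - P \<tau>"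
      using unbounded by blast
    have "z t - z \<tau> \<le> (- \<epsilon> * P t + L * G t) - (- \<epsilon> * P \<tau> + L * G \<tau>)"
    proof (rule primitive_mono[OF z primitive_add[OF primitive_cmult[OF P] primitive_cmult[OF G]] order_refl t(1)])
      fix r assume "\<tau> \<le> r"
      then have "\<alpha> r * \<epsilon> \<le> \<alpha> r * z r"
        using big[of r] nonneg(1) by (intro mult_left_mono) auto
      then show "w r \<le> - \<epsilon> * \<alpha> r + L * \<gamma> r"
        using w[OF \<open>\<tau> \<le> r\<close>] by (simp add: mult.commute)
    qed
    moreover have "L * (G t - G \<tau>) \<le> L * \<delta>"
      using small[OF t(1)] \<open>0 \<le> L\<close> by (rule mult_left_mono)
    moreover have "z \<tau> + L * \<delta> \<le> \<epsilon> * (P t - P \<tau>)"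
      using t(2) \<open>\<epsilon> > 0\<close> by (simp add: pos_divide_le_eq mult.commute)
    ultimately have "z t \<le> 0"
      by (simp add: algebra_simps)
    then show False using big[OF t(1)] \<open>\<epsilon> > 0\<close> by linarith
  qed
  then obtain s where s: "\<tau> \<le> s" "z s \<le> \<epsilon>" by blast
  have "z t \<le> \<epsilon> + L * \<delta>" if "s \<le> t" for t
  proof -
    have "z t - z s \<le> L * G t - L * G s"
    proof (rule primitive_mono[OF z primitive_cmult[OF G] s(1) that])
      fix r assume "s \<le> r"
      then show "w r \<le> L * \<gamma> r"
        using w[of r] nonneg(1,3)[of r] s(1) mult_nonneg_nonneg[of "\<alpha> r" "z r"] by linarith
    qed
    moreover have "G \<tau> \<le> G s"
      using has_integral_nonneg[OF primitive_increment[OF G order_refl s(1)]] nonneg(2) by auto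
    then have "L * (G t - G s) \<le> L * \<delta>"
      using small[of t] s(1) that \<open>0 \<le> L\<close> by (intro mult_left_mono) auto
    ultimately show ?thesis using s(2) by (simp add: algebra_simps)
  qed
  then show ?thesis
    using eventually_at_top_linorder by blast
qed

section \<open>Determinants of diagonal blocks\<close>

text \<open>The product rule in each term of the Leibniz formula, followed by exchanging the sum
  over permutations with the sum over the differentiated row.\<close>

lemma primitive_det:
  fixes X :: "real \<Rightarrow> real^'n^'n"
  assumes X: "\<And>i j. primitive a (\<lambda>t. X t $ i $ j) (\<lambda>t. U t $ i $ j)"
  shows "primitive a (\<lambda>t. det (X t)) (\<lambda>t. \<Sum>i\<in>UNIV. det (\<chi> k. if k = i then U t $ i else X t $ k))"
proof -
  let ?p = "{p. p permutes (UNIV::'n set)}"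
  have prod_eq: "(\<Prod>k\<in>UNIV. (\<chi> k. if k = i then U t $ i else X t $ k) $ k $ p k)
      = U t $ i $ p i * (\<Prod>k\<in>UNIV-{i}. X t $ k $ p k)" for p t i
  proof -
    have "(\<Prod>k\<in>UNIV-{i}. (\<chi> k. if k = i then U t $ i else X t $ k) $ k $ p k) = (\<Prod>k\<in>UNIV-{i}. X t $ k $ p k)"
      by (rule prod.cong) auto
    then show ?thesis
      by (subst prod.remove[of _ i]) auto
  qed
  have "primitive a (\<lambda>t. \<Sum>p\<in>?p. of_int (sign p) * (\<Prod>i\<in>UNIV. X t $ i $ p i))
     (\<lambda>t. \<Sum>p\<in>?p. of_int (sign p) * (\<Sum>i\<in>UNIV. U t $ i $ p i * (\<Prod>k\<in>UNIV-{i}. X t $ k $ p k)))"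
    by (intro primitive_sum primitive_cmult primitive_prod X) auto
  then show ?thesis
  proof (rule primitive_cong)
    fix t
    have "(\<Sum>p\<in>?p. of_int (sign p) * (\<Sum>i\<in>UNIV. U t $ i $ p i * (\<Prod>k\<in>UNIV-{i}. X t $ k $ p k)))
       = (\<Sum>i\<in>UNIV. \<Sum>p\<in>?p. of_int (sign p) * (U t $ i $ p i * (\<Prod>k\<in>UNIV-{i}. X t $ k $ p k)))"
      by (simp only: sum_distrib_left) (rule sum.swap)
    also have "\<dots> = (\<Sum>i\<in>UNIV. det (\<chi> k. if k = i then U t $ i else X t $ k))"
      unfolding det_def prod_eq ..
    finally show "(\<Sum>p\<in>?p. of_int (sign p) * (\<Sum>i\<in>UNIV. U t $ i $ p i * (\<Prod>k\<in>UNIV-{i}. X t $ k $ p k)))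
       = (\<Sum>i\<in>UNIV. det (\<chi> k. if k = i then U t $ i else X t $ k))" .
  qed (simp add: det_def)
qed

text \<open>Each Leibniz term has exactly one factor from row \<open>i\<close>, its other factors
  are at most 1 in absolute value, and there are \<open>fact CARD('n)\<close> terms.\<close>

lemma abs_det_le:
  fixes Y :: "real^'n^'n"
  assumes "\<And>k j. k \<noteq> i \<Longrightarrow> \<bar>Y $ k $ j\<bar> \<le> 1" and "\<And>j. \<bar>Y $ i $ j\<bar> \<le> b"
  shows "\<bar>det Y\<bar> \<le> fact CARD('n) * b"
proof -
  let ?p = "{p. p permutes (UNIV::'n set)}"
  \<comment> \<open>Any column index will do; the index type is non-empty.\<close>
  have "0 \<le> b" using assms(2)[of undefined] by linarith
  have "\<bar>det Y\<bar> \<le> (\<Sum>p\<in>?p. \<bar>of_int (sign p) * (\<Prod>k\<in>UNIV. Y $ k $ p k)\<bar>)"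
    unfolding det_def by (rule sum_abs)
  also have "\<dots> \<le> (\<Sum>p\<in>?p. b)"
  proof (rule sum_mono)
    fix p :: "'n \<Rightarrow> 'n"
    have "\<bar>of_int (sign p) * (\<Prod>k\<in>UNIV. Y $ k $ p k)\<bar> = \<bar>Y $ i $ p i\<bar> * (\<Prod>k\<in>UNIV-{i}. \<bar>Y $ k $ p k\<bar>)"
      by (simp add: abs_mult abs_prod sign_def prod.remove[of UNIV i])
    also have "\<dots> \<le> b * (\<Prod>k\<in>UNIV-{i}. 1)"
      using assms \<open>0 \<le> b\<close> by (intro mult_mono prod_mono) (auto intro: prod_nonneg)
    finally show "\<bar>of_int (sign p) * (\<Prod>k\<in>UNIV. Y $ k $ p k)\<bar> \<le> b" by simp
  qed
  also have "\<dots> = fact CARD('n) * b"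
    by (simp add: card_permutations)
  finally show ?thesis .
qed

text \<open>The diagonal block of \<open>M\<close> on \<open>C\<close>, padded with the identity so that its determinant is
  the determinant of the block.\<close>

definition block :: "'n set \<Rightarrow> real^'n^'n \<Rightarrow> real^'n^'n" where
  "block C M = (\<chi> i j. if i \<in> C \<and> j \<in> C then M $ i $ j else if i = j then 1 else 0)"

lemma block_component:
  "block C M $ i $ j = (if i \<in> C \<and> j \<in> C then M $ i $ j else if i = j then 1 else 0)"
  by (simp add: block_def)

text \<open>The new row combines the rows of \<open>M\<close>, cut off outside \<open>C\<close>,
  with coefficients \<open>a l\<close>. For \<open>l\<close> in \<open>C\<close> it adds a multiple
  of a row of the block, which repeats an existing row unless \<open>l = i\<close>; the rows from
  outside \<open>C\<close> form the remainder, whose coefficients are flows across the boundary of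
  \<open>C\<close>.\<close>

lemma det_block_replace_row:
  fixes M :: "real^'n^'n"
  assumes "i \<in> C"
  shows "det (\<chi> k. if k = i then (\<chi> j. if j \<in> C then \<Sum>l\<in>UNIV. a l * M $ l $ j else 0) else block C M $ k)
    = a i * det (block C M)
      + det (\<chi> k. if k = i then (\<chi> j. if j \<in> C then \<Sum>l\<in>-C. a l * M $ l $ j else 0) else block C M $ k)"
proof -
  let ?B = "block C M"
  let ?r = "\<chi> j. if j \<in> C then \<Sum>l\<in>-C. a l * M $ l $ j else 0"
  have B: "?B $ l $ j = (if j \<in> C then M $ l $ j else 0)" if "l \<in> C" for l j
    using that by (auto simp: block_component)
  have row: "(\<chi> j. if j \<in> C then \<Sum>l\<in>UNIV. a l * M $ l $ j else 0) = (\<Sum>l\<in>C. a l *s ?B $ l) + ?r"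
  proof (simp add: vec_eq_iff B, intro allI impI)
    fix j
    have "(\<Sum>l\<in>UNIV. a l * M $ l $ j) = (\<Sum>l\<in>C. a l * M $ l $ j) + (\<Sum>l\<in>UNIV-C. a l * M $ l $ j)"
      by (subst sum.subset_diff[of C UNIV]) auto
    then show "(\<Sum>l\<in>UNIV. a l * M $ l $ j) = (\<Sum>l\<in>C. a l * M $ l $ j) + (\<Sum>l\<in>-C. a l * M $ l $ j)"
      by (simp only: Compl_eq_Diff_UNIV)
  qed
  have det_row_eq: "det (\<chi> k. if k = i then ?B $ l else ?B $ k) = (if l = i then det ?B else 0)" for l
  proof (cases "l = i")
    case True
    then have "(\<chi> k. if k = i then ?B $ l else ?B $ k) = ?B" by (simp add: vec_eq_iff)
    then show ?thesis using True by simp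
  next
    case False
    then have "det (\<chi> k. if k = i then ?B $ l else ?B $ k) = 0"
      by (intro det_identical_rows[of i l]) (auto simp: row_def vec_eq_iff)
    then show ?thesis using False by simp
  qed
  have "det (\<chi> k. if k = i then \<Sum>l\<in>C. a l *s ?B $ l else ?B $ k)
       = (\<Sum>l\<in>C. det (\<chi> k. if k = i then a l *s ?B $ l else ?B $ k))"
    by (rule det_linear_row_sum[where a="\<lambda>_ l. a l *s ?B $ l" and c="\<lambda>k. ?B $ k"]) simp
  also have "\<dots> = (\<Sum>l\<in>C. a l * det (\<chi> k. if k = i then ?B $ l else ?B $ k))"
    by (intro sum.cong refl det_row_mul[where a="\<lambda>_. ?B $ l" and b="\<lambda>k. ?B $ k" for l])
  also have "\<dots> = (\<Sum>l\<in>C. if l = i then a l * det ?B else 0)"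
    unfolding det_row_eq by (intro sum.cong) auto
  also have "\<dots> = a i * det ?B"
    using \<open>i \<in> C\<close> by (simp add: sum.delta)
  finally show ?thesis
    unfolding row det_row_add[where a="\<lambda>_. \<Sum>l\<in>C. a l *s ?B $ l" and b="\<lambda>_. ?r" and c="\<lambda>k. ?B $ k"]
    by simp
qed

section \<open>Components of the infinite flow graph\<close>

lemma chain_offdiag_nonneg: "\<lbrakk>ct_chain A; 0 \<le> t; i \<noteq> j\<rbrakk> \<Longrightarrow> 0 \<le> A t $ i $ j"
  by (simp add: ct_chain_def)

lemma chain_diag_le:
  assumes "ct_chain A" "0 \<le> t" "i \<noteq> j"
  shows "A t $ i $ i \<le> - A t $ i $ j"
proof -
  have "0 = A t $ i $ i + (\<Sum>k\<in>UNIV-{i}. A t $ i $ k)"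
    using assms by (simp add: ct_chain_def sum.remove[of UNIV i, symmetric])
  moreover have "A t $ i $ j \<le> (\<Sum>k\<in>UNIV-{i}. A t $ i $ k)"
    using assms by (intro member_le_sum) (auto intro: chain_offdiag_nonneg)
  ultimately show ?thesis by linarith
qed

lemma chain_diag_nonpos:
  assumes "ct_chain A" "0 \<le> t"
  shows "A t $ i $ i \<le> 0"
proof -
  have "A t $ i $ i + (\<Sum>k\<in>UNIV-{i}. A t $ i $ k) = 0"
    using assms by (simp add: ct_chain_def sum.remove[of UNIV i, symmetric])
  moreover have "0 \<le> (\<Sum>k\<in>UNIV-{i}. A t $ i $ k)"
    using assms by (intro sum_nonneg) (auto intro: chain_offdiag_nonneg)
  ultimately show ?thesis by linarith
qed

text \<open>Both directions across the cut are counted, so the summands are the integrands that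
  define the infinite flow graph and the total is the same for \<open>C\<close> and its
  complement.\<close>

definition cross_flow :: "(real \<Rightarrow> real^'n^'n) \<Rightarrow> 'n set \<Rightarrow> real \<Rightarrow> real" where
  "cross_flow A C t = (\<Sum>i\<in>C. \<Sum>k\<in>-C. A t $ i $ k + A t $ k $ i)"

lemma cross_flow_Compl: "cross_flow A (-C) t = cross_flow A C t"
  unfolding cross_flow_def by (subst sum.swap) (simp add: add.commute)

lemma cross_flow_primitive:
  assumes "ct_chain A" "0 \<le> \<tau>"
  shows "primitive \<tau> (\<lambda>t. integral {\<tau>..t} (cross_flow A C)) (cross_flow A C)"
  unfolding cross_flow_def
  by (intro primitive_integral absolutely_integrable_sum set_integral_add
        chain_abs_integrable assms) auto

lemma inflow_le_cross_flow:
  assumes "ct_chain A" "0 \<le> t"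
  shows "(\<Sum>i\<in>C. \<Sum>k\<in>-C. A t $ i $ k) \<le> cross_flow A C t"
  unfolding cross_flow_def
  using assms by (intro sum_mono) (auto intro: chain_offdiag_nonneg)

lemma cross_flow_nonneg: "\<lbrakk>ct_chain A; 0 \<le> t\<rbrakk> \<Longrightarrow> 0 \<le> cross_flow A C t"
  unfolding cross_flow_def by (intro sum_nonneg add_nonneg_nonneg) (auto intro: chain_offdiag_nonneg)

lemma eventually_cross_flow_small:
  fixes A :: "real \<Rightarrow> real^'n^'n"
  assumes A: "ct_chain A" and "e > 0"
    and fin: "\<And>i k. \<lbrakk>i \<in> C; k \<notin> C\<rbrakk> \<Longrightarrow> (i, k) \<notin> infinite_flow_graph A"
  shows "\<forall>\<^sub>F \<tau> in at_top. \<forall>t\<ge>\<tau>. integral {\<tau>..t} (cross_flow A C) \<le> e"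
proof -
  let ?f = "\<lambda>p t. A t $ fst p $ snd p + A t $ snd p $ fst p"
  let ?S = "C \<times> (-C)"
  \<comment> \<open>The added 1 keeps the equal share \<open>e / m\<close> of each pair well defined
    when no pair crosses the cut.\<close>
  define m where "m = real (card ?S) + 1"
  have "m > 0" unfolding m_def by (rule add_nonneg_pos) auto
  define d where "d = e / m"
  have "d > 0" using \<open>e > 0\<close> \<open>m > 0\<close> by (simp add: d_def)
  have "\<forall>\<^sub>F \<tau> in at_top. \<forall>t\<ge>\<tau>. integral {\<tau>..t} (?f p) \<le> d" if "p \<in> ?S" for p
  proof (rule eventually_integral_le_if_nn_integral_finite)
    show "(\<integral>\<^sup>+t\<in>{0..}. ennreal (?f p t) \<partial>lebesgue) \<noteq> \<infinity>"
      using fin[of "fst p" "snd p"] that by (auto simp: infinite_flow_graph_def)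
    show "?f p absolutely_integrable_on {0..t}" for t
      by (intro set_integral_add chain_abs_integrable[OF A]) auto
  qed (use that \<open>d > 0\<close> in \<open>auto intro!: add_nonneg_nonneg chain_offdiag_nonneg[OF A]\<close>)
  then have "\<forall>\<^sub>F \<tau> in at_top. \<forall>p\<in>?S. \<forall>t\<ge>\<tau>. integral {\<tau>..t} (?f p) \<le> d"
    by (intro eventually_ball_finite) auto
  then show ?thesis
    using eventually_ge_at_top[of 0]
  proof eventually_elim
    case (elim \<tau>)
    show ?case
    proof (intro allI impI)
      fix t assume "\<tau> \<le> t"
      have "cross_flow A C = (\<lambda>s. \<Sum>p\<in>?S. ?f p s)"
        by (simp add: fun_eq_iff cross_flow_def sum.cartesian_product case_prod_beta)
      then have "integral {\<tau>..t} (cross_flow A C) = integral {\<tau>..t} (\<lambda>s. \<Sum>p\<in>?S. ?f p s)"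
        by simp
      also have "\<dots> = (\<Sum>p\<in>?S. integral {\<tau>..t} (?f p))"
        using elim(2) primitive_integrable[OF chain_primitive[OF A]]
        by (intro Henstock_Kurzweil_Integration.integral_sum integrable_add) auto
      also have "\<dots> \<le> (\<Sum>p\<in>?S. d)"
        using elim(1) \<open>\<tau> \<le> t\<close> by (intro sum_mono) blast
      also have "\<dots> \<le> m * d"
        using \<open>d > 0\<close> by (simp add: m_def algebra_simps)
      also have "\<dots> = e"
        using \<open>m > 0\<close> by (simp add: d_def)
      finally show "integral {\<tau>..t} (cross_flow A C) \<le> e" .
    qed
  qed
qed

text \<open>The part of column \<open>j\<close> outside \<open>C\<close> starts at 0 and solves the
  system restricted to \<open>-C\<close>, whose row sums are at most 0, with the entries inside
  \<open>C\<close> acting as a forcing. This forcing is at most the cross flow because all entries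
  are bounded by 1, so the maximum principle applies.\<close>

lemma state_transition_off_block_le:
  assumes A: "ct_chain A" and \<tau>: "0 \<le> \<tau>" "\<tau> \<le> t" and ij: "i \<notin> C" "j \<in> C"
  shows "\<bar>state_transition A t \<tau> $ i $ j\<bar> \<le> integral {\<tau>..t} (cross_flow A C)"
proof -
  let ?x = "\<lambda>k t. state_transition A t \<tau> $ k $ j"
  have "\<bar>?x i t\<bar> \<le> 0 + (integral {\<tau>..t} (cross_flow A C) - integral {\<tau>..\<tau>} (cross_flow A C))"
  proof (rule max_principle[where I="-C" and x="?x" and b="\<lambda>i k t. A t $ i $ k"
        and r="\<lambda>k t. \<Sum>l\<in>C. A t $ k $ l * ?x l t" and R="\<lambda>t. integral {\<tau>..t} (cross_flow A C)"])
    show "primitive \<tau> (?x k) (\<lambda>t. (\<Sum>l\<in>-C. A t $ k $ l * ?x l t) + (\<Sum>l\<in>C. A t $ k $ l * ?x l t))" for k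
    proof (rule primitive_cong[OF state_transition_primitive[OF A \<tau>(1)]])
      fix t
      show "(\<Sum>l\<in>UNIV. A t $ k $ l * ?x l t) = (\<Sum>l\<in>-C. A t $ k $ l * ?x l t) + (\<Sum>l\<in>C. A t $ k $ l * ?x l t)"
        unfolding Compl_eq_Diff_UNIV by (rule sum.subset_diff) auto
    qed simp
    show "\<bar>\<Sum>l\<in>C. A s $ k $ l * ?x l s\<bar> \<le> cross_flow A C s" if "k \<in> -C" "\<tau> \<le> s" for k s
    proof -
      have "\<bar>\<Sum>l\<in>C. A s $ k $ l * ?x l s\<bar> \<le> (\<Sum>l\<in>C. A s $ k $ l)"
      proof (intro order_trans[OF sum_abs] sum_mono)
        fix l assume "l \<in> C"
        then have "0 \<le> A s $ k $ l"
          using that \<tau> by (intro chain_offdiag_nonneg[OF A]) auto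
        then show "\<bar>A s $ k $ l * ?x l s\<bar> \<le> A s $ k $ l"
          using state_transition_entry_abs_le[OF A \<tau>(1) \<open>\<tau> \<le> s\<close>]
          by (simp add: abs_mult mult_left_le)
      qed
      also have "\<dots> \<le> (\<Sum>k\<in>-C. \<Sum>l\<in>C. A s $ k $ l)"
        using that \<tau>
        by (intro member_le_sum[where f="\<lambda>k. \<Sum>l\<in>C. A s $ k $ l"] sum_nonneg chain_offdiag_nonneg[OF A]) auto
      also have "\<dots> \<le> cross_flow A C s"
        using inflow_le_cross_flow[OF A, of s "-C"] that \<tau> by (simp add: cross_flow_Compl)
      finally show ?thesis .
    qed
    show "(\<Sum>l\<in>-C. A s $ k $ l) \<le> 0" if "k \<in> -C" "\<tau> \<le> s" for k s
    proof -
      have "(\<Sum>l\<in>-C. A s $ k $ l) + (\<Sum>l\<in>C. A s $ k $ l) = (\<Sum>l\<in>UNIV. A s $ k $ l)"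
        unfolding Compl_eq_Diff_UNIV by (rule sum.subset_diff[symmetric]) auto
      moreover have "0 \<le> (\<Sum>l\<in>C. A s $ k $ l)"
        using that \<tau> by (intro sum_nonneg chain_offdiag_nonneg[OF A]) auto
      moreover have "(\<Sum>l\<in>UNIV. A s $ k $ l) = 0"
        using A that \<tau> by (simp add: ct_chain_def)
      ultimately show ?thesis by linarith
    qed
    show "\<bar>?x k \<tau>\<bar> \<le> 0" if "k \<in> -C" for k
      using ij that state_transition_self[OF A \<tau>(1)] by (auto simp: mat_def)
  qed (use ij \<tau> chain_primitive[OF A] cross_flow_primitive[OF A] chain_offdiag_nonneg[OF A] in auto)
  then show ?thesis by simp
qed

text \<open>Squaring removes the sign of the determinant \<open>y\<close>: the derivative of
  \<open>y * y\<close> is at most minus the edge weight times \<open>y * y\<close> plus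
  \<open>2 * K\<^sup>2\<close> times the cross flow. This is the situation of
  \<open>primitive_decay\<close>, with damping of infinite integral supplied by the edge.\<close>

lemma eventually_det_block_small:
  fixes A :: "real \<Rightarrow> real^'n^'n"
  assumes A: "ct_chain A" and \<tau>: "0 \<le> \<tau>" and edge: "(p, q) \<in> infinite_flow_graph A" "p \<in> C" "q \<in> C"
    and small: "\<And>t. \<tau> \<le> t \<Longrightarrow> integral {\<tau>..t} (cross_flow A C) \<le> \<delta>" and "\<epsilon> > 0"
  shows "\<forall>\<^sub>F t in at_top. (det (block C (state_transition A t \<tau>)))\<^sup>2 \<le> \<epsilon> + 2 * (fact CARD('n))\<^sup>2 * \<delta>"
proof -
  define M where "M t = state_transition A t \<tau>" for t
  let ?X = "\<lambda>t. block C (M t)"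
  let ?U = "\<lambda>t. (\<chi> i j. if i \<in> C \<and> j \<in> C then \<Sum>l\<in>UNIV. A t $ i $ l * M t $ l $ j else 0) :: real^'n^'n"
  let ?r = "\<lambda>t i. (\<chi> j. if j \<in> C then \<Sum>l\<in>-C. A t $ i $ l * M t $ l $ j else 0) :: real^'n"
  define \<rho> where "\<rho> t i = det (\<chi> k. if k = i then ?r t i else ?X t $ k)" for t i
  define K :: real where "K = fact CARD('n)"
  have "0 \<le> K" by (simp add: K_def)
  define y where "y t = det (?X t)" for t
  define y' where "y' t = (\<Sum>i\<in>C. A t $ i $ i) * y t + (\<Sum>i\<in>C. \<rho> t i)" for t
  have "p \<noteq> q" and inf: "(\<integral>\<^sup>+t\<in>{0..}. ennreal (A t $ p $ q + A t $ q $ p) \<partial>lebesgue) = \<infinity>"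
    using edge(1) by (auto simp: infinite_flow_graph_def)
  have M_le: "\<bar>M t $ i $ j\<bar> \<le> 1" if "\<tau> \<le> t" for t i j
    unfolding M_def by (rule state_transition_entry_abs_le[OF A \<tau> that])
  have X_le: "\<bar>?X t $ i $ j\<bar> \<le> 1" if "\<tau> \<le> t" for t i j
    using M_le[OF that] by (simp add: block_component)
  have y_le: "\<bar>y t\<bar> \<le> K" if "\<tau> \<le> t" for t
    using abs_det_le[of undefined "?X t" 1] X_le[OF that] by (simp add: y_def K_def)
  have "primitive \<tau> (\<lambda>t. ?X t $ i $ j) (\<lambda>t. ?U t $ i $ j)" for i j
    using state_transition_primitive[OF A \<tau>, of i j]
    by (cases "i \<in> C \<and> j \<in> C") (auto simp: block_component M_def[symmetric] primitive_const)
  then have "primitive \<tau> y (\<lambda>t. \<Sum>i\<in>UNIV. det (\<chi> k. if k = i then ?U t $ i else ?X t $ k))"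
    unfolding y_def by (rule primitive_det)
  then have y: "primitive \<tau> y y'"
  proof (rule primitive_cong)
    fix t
    have 1: "det (\<chi> k. if k = i then ?U t $ i else ?X t $ k) = A t $ i $ i * y t + \<rho> t i" if "i \<in> C" for i
    proof -
      have "?U t $ i = (\<chi> j. if j \<in> C then \<Sum>l\<in>UNIV. A t $ i $ l * M t $ l $ j else 0)"
        using that by (simp add: vec_eq_iff)
      then show ?thesis
        unfolding y_def \<rho>_def by (simp only: det_block_replace_row[OF that])
    qed
    \<comment> \<open>Rows outside \<open>C\<close> are constant padding, so differentiating one of
      them produces a zero row.\<close>
    have 2: "det (\<chi> k. if k = i then ?U t $ i else ?X t $ k) = 0" if "i \<notin> C" for i
    proof -
      have "?U t $ i = 0"
        using that by (simp add: vec_eq_iff)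
      then show ?thesis
        by (simp only: det_row_0)
    qed
    have "(\<Sum>i\<in>UNIV. det (\<chi> k. if k = i then ?U t $ i else ?X t $ k))
        = (\<Sum>i\<in>C. det (\<chi> k. if k = i then ?U t $ i else ?X t $ k))"
      using 2 by (intro sum.mono_neutral_right) auto
    also have "\<dots> = (\<Sum>i\<in>C. A t $ i $ i * y t + \<rho> t i)"
      using 1 by (rule sum.cong[OF refl])
    also have "\<dots> = y' t"
      by (simp add: y'_def sum.distrib sum_distrib_right)
    finally show "(\<Sum>i\<in>UNIV. det (\<chi> k. if k = i then ?U t $ i else ?X t $ k)) = y' t" .
  qed simp
  have \<rho>_le: "\<bar>\<rho> t i\<bar> \<le> K * (\<Sum>l\<in>-C. A t $ i $ l)" if "\<tau> \<le> t" "i \<in> C" for t i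
    unfolding \<rho>_def K_def
  proof (rule abs_det_le[of i])
    fix j
    have "0 \<le> A t $ i $ l" if "l \<in> -C" for l
      using that \<open>\<tau> \<le> t\<close> \<open>i \<in> C\<close> \<tau> by (intro chain_offdiag_nonneg[OF A]) auto
    then have *: "\<bar>A t $ i $ l * M t $ l $ j\<bar> \<le> A t $ i $ l" "0 \<le> A t $ i $ l" if "l \<in> -C" for l
      using that M_le[OF \<open>\<tau> \<le> t\<close>] by (auto simp: abs_mult mult_left_le)
    show "\<bar>(\<chi> k. if k = i then ?r t i else ?X t $ k) $ i $ j\<bar> \<le> (\<Sum>l\<in>-C. A t $ i $ l)"
      using * by (auto intro!: order_trans[OF sum_abs] sum_mono sum_nonneg)
  qed (use X_le[OF that(1)] in auto)
  \<comment> \<open>The two endpoints of the edge account for both of its directions; all other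
    diagonal entries are non-positive.\<close>
  have trace: "(\<Sum>i\<in>C. A t $ i $ i) \<le> - (A t $ p $ q + A t $ q $ p)" if "\<tau> \<le> t" for t
  proof -
    have "(\<Sum>i\<in>{p, q}. - A t $ i $ i) \<le> (\<Sum>i\<in>C. - A t $ i $ i)"
      using edge that \<tau> chain_diag_nonpos[OF A, of t] by (intro sum_mono2) auto
    then have "(\<Sum>i\<in>C. A t $ i $ i) \<le> (\<Sum>i\<in>{p, q}. A t $ i $ i)"
      by (simp add: sum_negf)
    then show ?thesis
      using chain_diag_le[OF A _ \<open>p \<noteq> q\<close>, of t] chain_diag_le[OF A _ \<open>p \<noteq> q\<close>[symmetric], of t]
        \<open>p \<noteq> q\<close> that \<tau> by simp
  qed
  have edge_nonneg: "0 \<le> A t $ p $ q + A t $ q $ p" if "0 \<le> t" for t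
    using that \<open>p \<noteq> q\<close> by (intro add_nonneg_nonneg chain_offdiag_nonneg[OF A]) auto
  have edge_int: "(\<lambda>t. A t $ p $ q + A t $ q $ p) absolutely_integrable_on {s..t}" if "0 \<le> s" for s t
    by (intro set_integral_add chain_abs_integrable[OF A that])
  have "\<forall>\<^sub>F t in at_top. y t * y t \<le> \<epsilon> + 2 * K\<^sup>2 * \<delta>"
  proof (rule primitive_decay[OF primitive_mult[OF y y] primitive_integral[OF edge_int[OF \<tau>]] cross_flow_primitive[OF A \<tau>, of C]])
    fix t assume "\<tau> \<le> t"
    with \<tau> have "0 \<le> t" by simp
    have "(\<Sum>i\<in>C. A t $ i $ i) * (y t * y t) \<le> - (A t $ p $ q + A t $ q $ p) * (y t * y t)"
      by (intro mult_right_mono trace \<open>\<tau> \<le> t\<close>) simp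
    \<comment> \<open>The derivative of the square contains the edge term twice; this allows one
      copy to be dropped.\<close>
    moreover have "0 \<le> (A t $ p $ q + A t $ q $ p) * (y t * y t)"
      by (rule mult_nonneg_nonneg[OF edge_nonneg[OF \<open>0 \<le> t\<close>] zero_le_square])
    moreover have "y t * (\<Sum>i\<in>C. \<rho> t i) \<le> K * (K * cross_flow A C t)"
    proof -
      have "\<bar>\<Sum>i\<in>C. \<rho> t i\<bar> \<le> K * (\<Sum>i\<in>C. \<Sum>l\<in>-C. A t $ i $ l)"
        unfolding sum_distrib_left[of K]
        using \<rho>_le[OF \<open>\<tau> \<le> t\<close>] by (intro order_trans[OF sum_abs] sum_mono) (auto simp: sum_distrib_left)
      also have "\<dots> \<le> K * cross_flow A C t"
        by (intro mult_left_mono inflow_le_cross_flow[OF A \<open>0 \<le> t\<close>] \<open>0 \<le> K\<close>)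
      finally have "\<bar>y t\<bar> * \<bar>\<Sum>i\<in>C. \<rho> t i\<bar> \<le> K * (K * cross_flow A C t)"
        using y_le[OF \<open>\<tau> \<le> t\<close>] by (intro mult_mono) auto
      then show ?thesis
        by (metis abs_ge_self abs_mult order_trans)
    qed
    ultimately show "y' t * y t + y t * y' t
        \<le> - ((A t $ p $ q + A t $ q $ p) * (y t * y t)) + 2 * K\<^sup>2 * cross_flow A C t"
      unfolding y'_def by (simp add: algebra_simps power2_eq_square)
  next
    show "\<exists>t\<ge>\<tau>. k \<le> integral {\<tau>..t} (\<lambda>t. A t $ p $ q + A t $ q $ p)
        - integral {\<tau>..\<tau>} (\<lambda>t. A t $ p $ q + A t $ q $ p)" for k
      using integral_unbounded_if_nn_integral_infinite[OF edge_nonneg edge_int inf \<tau>] by simp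
  qed (use small edge_nonneg cross_flow_nonneg[OF A] \<tau> \<open>\<epsilon> > 0\<close> in auto)
  then show ?thesis
    by (simp add: y_def K_def M_def power2_eq_square)
qed

text \<open>A path from the representative \<open>a\<close> to a second node has a first edge, and
  both of its ends are reachable from \<open>a\<close>.\<close>

lemma component_edge:
  fixes A :: "real \<Rightarrow> real^'n^'n"
  assumes "C \<in> graph_components (infinite_flow_graph A)" "2 \<le> card C"
  obtains p q where "(p, q) \<in> infinite_flow_graph A" "p \<in> C" "q \<in> C"
proof -
  let ?E = "infinite_flow_graph A"
  obtain a where C: "C = ?E\<^sup>* `` {a}"
    using assms(1) by (auto simp: graph_components_def quotient_def)
  have "C \<noteq> {a}" using assms(2) by auto
  moreover have "a \<in> C" by (simp add: C)
  ultimately obtain b where "b \<in> C" "b \<noteq> a" by blast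
  then have "(a, b) \<in> ?E\<^sup>*" by (simp add: C)
  then obtain c where "(a, c) \<in> ?E"
    using \<open>b \<noteq> a\<close> by (metis converse_rtranclE)
  then show ?thesis
    using that[of a c] by (auto simp: C)
qed

lemma component_no_exit:
  assumes "C \<in> graph_components E" "i \<in> C" "k \<notin> C"
  shows "(i, k) \<notin> E"
  using assms by (auto simp: graph_components_def quotient_def intro: rtrancl_into_rtrancl)

text \<open>The nesting of the quantifiers follows the two estimates: a late \<tau> makes the
  remaining cross flow small, and for that fixed \<tau> the determinant becomes small at late times
  \<open>t\<close>.\<close>

lemma eventually_state_transition_component:
  fixes A :: "real \<Rightarrow> real^'n^'n"
  assumes A: "ct_chain A" and C: "C \<in> graph_components (infinite_flow_graph A)" "2 \<le> card C" and "e > 0"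
  shows "\<forall>\<^sub>F \<tau> in at_top. \<forall>\<^sub>F t in at_top.
           (det (block C (state_transition A t \<tau>)))\<^sup>2 \<le> e \<and>
           (\<forall>i j. i \<notin> C \<longrightarrow> j \<in> C \<longrightarrow> \<bar>state_transition A t \<tau> $ i $ j\<bar> \<le> e)"
proof -
  obtain p q where pq: "(p, q) \<in> infinite_flow_graph A" "p \<in> C" "q \<in> C"
    using component_edge[OF C] .
  define L :: real where "L = 2 * (fact CARD('n))\<^sup>2"
  have "L > 0" by (simp add: L_def)
  \<comment> \<open>The first argument of \<open>min\<close> serves the entries outside the block;
    the second keeps the determinant error \<open>L * \<delta>\<close> within \<open>e / 2\<close>,
    leaving the other half for the decay.\<close>
  define \<delta> where "\<delta> = min e (e / (2 * L))"
  have "\<delta> > 0" "\<delta> \<le> e" "L * \<delta> \<le> e / 2"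
    using \<open>e > 0\<close> \<open>L > 0\<close> by (auto simp: \<delta>_def min_def field_simps)
  have "\<forall>\<^sub>F \<tau> in at_top. \<forall>t\<ge>\<tau>. integral {\<tau>..t} (cross_flow A C) \<le> \<delta>"
    using \<open>\<delta> > 0\<close> component_no_exit[OF C(1)] by (intro eventually_cross_flow_small[OF A]) auto
  then show ?thesis
    using eventually_ge_at_top[of 0]
  proof eventually_elim
    case (elim \<tau>)
    have "\<forall>\<^sub>F t in at_top. (det (block C (state_transition A t \<tau>)))\<^sup>2 \<le> e / 2 + L * \<delta>"
      unfolding L_def using elim \<open>e > 0\<close> by (intro eventually_det_block_small[OF A _ pq]) auto
    then show ?case
      using eventually_ge_at_top[of \<tau>]
    proof eventually_elim
      case (elim t)
      show ?case
      proof (intro conjI allI impI)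
        show "(det (block C (state_transition A t \<tau>)))\<^sup>2 \<le> e"
          using elim(1) \<open>L * \<delta> \<le> e / 2\<close> by simp
        show "\<bar>state_transition A t \<tau> $ i $ j\<bar> \<le> e" if "i \<notin> C" "j \<in> C" for i j
        proof -
          have "integral {\<tau>..t} (cross_flow A C) \<le> \<delta>"
            using \<open>\<forall>t\<ge>\<tau>. integral {\<tau>..t} (cross_flow A C) \<le> \<delta>\<close> elim(2) by blast
          then show ?thesis
            using state_transition_off_block_le[OF A \<open>0 \<le> \<tau>\<close> elim(2) that] \<open>\<delta> \<le> e\<close> by linarith
        qed
      qed
    qed
  qed
qed

section \<open>Limits of the transition matrices\<close>

text \<open>The kernel is the orthogonal complement of the row space.\<close>

lemma dim_kernel_plus_rank:
  fixes M :: "real^'n^'m"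
  shows "dim {x. M *v x = 0} + rank M = CARD('n)"
proof -
  have "{x. M *v x = 0} = {y \<in> UNIV. \<forall>x\<in>span (rows M). orthogonal x y}"
  proof (intro set_eqI iffI)
    fix x assume "x \<in> {x. M *v x = 0}"
    then show "x \<in> {y \<in> UNIV. \<forall>x\<in>span (rows M). orthogonal x y}"
      using orthogonal_nullspace_rowspace[of M x] by (auto simp: orthogonal_commute)
  next
    fix x assume "x \<in> {y \<in> UNIV. \<forall>x\<in>span (rows M). orthogonal x y}"
    then have "row i M \<bullet> x = 0" for i
      using span_base[of "row i M" "rows M"] by (auto simp: rows_def orthogonal_def)
    then show "x \<in> {x. M *v x = 0}"
      by (simp add: vec_eq_iff matrix_vector_mul_component row_def)
  qed
  then have "dim {x. M *v x = 0} + dim (span (rows M)) = dim (UNIV :: (real^'n) set)"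
    by (simp only: dim_subspace_orthogonal_to_vectors[OF subspace_span subspace_UNIV subset_UNIV])
  then show ?thesis by (simp add: row_rank_def)
qed

section \<open>Continuity of matrix operations and compactness\<close>

lemma tendsto_matrix_iff:
  fixes M :: "'a \<Rightarrow> real^'n^'m"
  shows "(M \<longlongrightarrow> L) F \<longleftrightarrow> (\<forall>i j. ((\<lambda>x. M x $ i $ j) \<longlongrightarrow> L $ i $ j) F)"
  by (metis (no_types) vec_tendstoI tendsto_vec_nth)

lemma tendsto_matrix_mult:
  fixes M :: "'a \<Rightarrow> real^'n^'m" and N :: "'a \<Rightarrow> real^'k^'n"
  assumes "(M \<longlongrightarrow> L) F" "(N \<longlongrightarrow> L') F"
  shows "((\<lambda>x. M x ** N x) \<longlongrightarrow> L ** L') F"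
  using assms by (auto simp: tendsto_matrix_iff matrix_matrix_mult_def intro!: tendsto_sum tendsto_mult)

lemma tendsto_matrix_vector_mult:
  fixes M :: "'a \<Rightarrow> real^'n^'m"
  assumes "(M \<longlongrightarrow> L) F"
  shows "((\<lambda>x. M x *v v) \<longlongrightarrow> L *v v) F"
  using assms
  by (intro vec_tendstoI) (auto simp: tendsto_matrix_iff matrix_vector_mult_def intro!: tendsto_sum tendsto_mult)

lemma tendsto_det:
  fixes M :: "'a \<Rightarrow> real^'n^'n"
  assumes "(M \<longlongrightarrow> L) F"
  shows "((\<lambda>x. det (M x)) \<longlongrightarrow> det L) F"
  unfolding det_def
  using assms by (intro tendsto_sum tendsto_mult tendsto_const tendsto_prod) (simp add: tendsto_matrix_iff)

lemma tendsto_block: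
  fixes M :: "'a \<Rightarrow> real^'n^'n"
  assumes "(M \<longlongrightarrow> L) F"
  shows "((\<lambda>x. block C (M x)) \<longlongrightarrow> block C L) F"
  using assms by (auto simp: tendsto_matrix_iff block_component)

lemma matrix_convergent_subsequence:
  fixes M :: "nat \<Rightarrow> real^'n^'m"
  assumes "\<And>k i j. \<bar>M k $ i $ j\<bar> \<le> 1"
  obtains L r where "strict_mono (r :: nat \<Rightarrow> nat)" "(\<lambda>k. M (r k)) \<longlonglongrightarrow> L"
proof -
  have "norm (M k) \<le> (\<Sum>i\<in>(UNIV::'m set). \<Sum>j\<in>(UNIV::'n set). 1)" for k
  proof -
    have "norm (M k) \<le> (\<Sum>i\<in>UNIV. norm (M k $ i))"
      unfolding norm_vec_def by (rule L2_set_le_sum) simp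
    also have "\<dots> \<le> (\<Sum>i\<in>(UNIV::'m set). \<Sum>j\<in>(UNIV::'n set). 1)"
    proof (rule sum_mono)
      fix i
      show "norm (M k $ i) \<le> (\<Sum>j\<in>(UNIV::'n set). 1)"
        using assms by (intro order_trans[OF norm_le_l1_cart] sum_mono)
    qed
    finally show ?thesis .
  qed
  then have "bounded (range M)"
    unfolding bounded_iff by blast
  then obtain L r where "strict_mono (r :: nat \<Rightarrow> nat)" "(M \<circ> r) \<longlonglongrightarrow> L"
    using bounded_imp_convergent_subsequence by blast
  then show ?thesis
    using that by (simp add: o_def)
qed

text \<open>The identity padding forces a kernel vector of the block to vanish outside
  \<open>C\<close>. On such a vector \<open>Q\<close> acts like the block in the rows of
  \<open>C\<close> and gives 0 in the other rows by \<open>off\<close>.\<close>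

lemma kernel_vector_supported_on_block:
  fixes Q :: "real^'n^'n"
  assumes "det (block C Q) = 0" and off: "\<And>i j. \<lbrakk>i \<notin> C; j \<in> C\<rbrakk> \<Longrightarrow> Q $ i $ j = 0"
  obtains w where "w \<noteq> 0" "Q *v w = 0" "\<forall>i. i \<notin> C \<longrightarrow> w $ i = 0"
proof -
  have "\<not> invertible (block C Q)"
    using assms(1) by (simp add: invertible_det_nz)
  then obtain w where w: "w \<noteq> 0" "block C Q *v w = 0"
    using matrix_left_invertible_ker[of "block C Q"] invertible_left_inverse[of "block C Q"] by blast
  then have eq: "(\<Sum>j\<in>UNIV. block C Q $ i $ j * w $ j) = 0" for i
    by (simp add: vec_eq_iff matrix_vector_mult_def)
  have zero: "w $ i = 0" if "i \<notin> C" for i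
  proof -
    have "(\<Sum>j\<in>UNIV. block C Q $ i $ j * w $ j) = (\<Sum>j\<in>UNIV. if i = j then w $ j else 0)"
      using that by (intro sum.cong) (auto simp: block_component)
    then show ?thesis using eq[of i] by simp
  qed
  have "(\<Sum>j\<in>UNIV. Q $ i $ j * w $ j) = 0" for i
  proof (cases "i \<in> C")
    case True
    have "(\<Sum>j\<in>UNIV. Q $ i $ j * w $ j) = (\<Sum>j\<in>UNIV. block C Q $ i $ j * w $ j)"
      using True zero by (intro sum.cong) (auto simp: block_component)
    then show ?thesis using eq by simp
  next
    case False
    have "Q $ i $ j * w $ j = 0" for j
      using False off zero by (cases "j \<in> C") auto
    then show ?thesis by (intro sum.neutral) blast
  qed
  then have "Q *v w = 0"
    by (simp add: vec_eq_iff matrix_vector_mult_def)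
  with w(1) zero show ?thesis by (intro that) auto
qed

text \<open>Vectors with disjoint supports are orthogonal, and pairwise orthogonal non-zero vectors
  are independent.\<close>

lemma card_le_dim_if_disjoint_supports:
  fixes S :: "(real^'n) set" and \<C> :: "'n set set"
  assumes "disjoint \<C>" and "\<And>C. C \<in> \<C> \<Longrightarrow> \<exists>w\<in>S. w \<noteq> 0 \<and> (\<forall>i. i \<notin> C \<longrightarrow> w $ i = 0)"
  shows "card \<C> \<le> dim S"
proof -
  obtain w where w: "\<And>C. C \<in> \<C> \<Longrightarrow> w C \<in> S" "\<And>C. C \<in> \<C> \<Longrightarrow> w C \<noteq> 0"
      "\<And>C i. \<lbrakk>C \<in> \<C>; i \<notin> C\<rbrakk> \<Longrightarrow> w C $ i = 0"
    using assms(2) by metis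
  have orth: "w C \<bullet> w D = 0" if "C \<in> \<C>" "D \<in> \<C>" "C \<noteq> D" for C D
  proof -
    have "C \<inter> D = {}" using assms(1) that by (auto simp: disjoint_def)
    then have "w C $ i * w D $ i = 0" for i
      using w(3)[OF that(1), of i] w(3)[OF that(2), of i] by auto
    then show ?thesis
      unfolding inner_vec_def inner_real_def by (intro sum.neutral) blast
  qed
  have "inj_on w \<C>"
    using orth w(2) by (intro inj_onI) (metis inner_eq_zero_iff)
  moreover have "independent (w ` \<C>)"
    using orth w(2) by (intro pairwise_orthogonal_independent) (auto simp: pairwise_def orthogonal_def)
  then have "card (w ` \<C>) \<le> dim S"
    using w(1) by (intro independent_card_le_dim) auto
  ultimately show ?thesis
    by (simp add: card_image)
qed

lemma disjoint_graph_components: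
  assumes "sym E"
  shows "disjoint (graph_components E)"
proof -
  have "equiv UNIV (E\<^sup>*)"
    using assms by (intro equivI) (auto simp: refl_rtrancl sym_rtrancl trans_rtrancl)
  then show ?thesis
    unfolding disjoint_def graph_components_def using quotient_disj by blast
qed

lemma sym_infinite_flow_graph: "sym (infinite_flow_graph A)"
  by (auto simp: sym_def infinite_flow_graph_def add.commute)

text \<open>Solutions do not increase in the maximum norm, so convergence to \<open>0\<close> along a subsequence
  suffices.\<close>

lemma null_space_limit:
  fixes A :: "real \<Rightarrow> real^'n^'n"
  assumes A: "ct_chain A" and s: "\<And>k. 0 \<le> s k"
    and P: "(\<lambda>k::nat. state_transition A (s k) 0) \<longlonglongrightarrow> P" and "P *v v = 0"
  shows "v \<in> null_space A 0"
proof -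
  have lim: "(\<lambda>k. state_transition A (s k) 0 *v v) \<longlonglongrightarrow> 0"
    using tendsto_matrix_vector_mult[OF P, of v] \<open>P *v v = 0\<close> by simp
  have "((\<lambda>t. (state_transition A t 0 *v v) $ i) \<longlongrightarrow> 0) at_top" for i
  proof (rule tendstoI)
    fix e :: real assume "e > 0"
    have "\<forall>\<^sub>F k in sequentially. norm (state_transition A (s k) 0 *v v) < e"
      using tendstoD[OF lim \<open>e > 0\<close>] by simp
    then obtain k where k: "norm (state_transition A (s k) 0 *v v) < e"
      using eventually_happens by fastforce
    have "\<bar>(state_transition A t 0 *v v) $ i\<bar> < e" if "s k \<le> t" for t
    proof -
      have "state_transition A t 0 *v v = state_transition A t (s k) *v (state_transition A (s k) 0 *v v)"
        using state_transition_mult[OF A order_refl s that] by (simp add: matrix_vector_mul_assoc)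
      then have "\<bar>(state_transition A t 0 *v v) $ i\<bar> \<le> norm (state_transition A (s k) 0 *v v)"
        using state_transition_mult_vec_abs_le[OF A s that] component_le_norm_cart by metis
      then show ?thesis using k by linarith
    qed
    then show "\<forall>\<^sub>F t in at_top. dist ((state_transition A t 0 *v v) $ i) 0 < e"
      unfolding eventually_at_top_linorder by auto
  qed
  then show ?thesis
    unfolding null_space_def mem_Collect_eq by (intro vec_tendstoI) simp
qed

text \<open>For each \<open>n\<close> first an index \<open>k\<close> and then an index
  \<open>l\<close>, both at least \<open>n\<close>, are chosen with accuracy
  \<open>1 / Suc n\<close>; as \<open>\<C>\<close> is finite, one choice serves all components. The
  matrices from \<open>s (k n)\<close> to \<open>s (l n)\<close> converge to \<open>Q\<close> along
  a subsequence, and since both index sequences tend to infinity the composition law turns into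
  \<open>Q ** P = P\<close>.\<close>

lemma ex_limit_matrices:
  fixes A :: "real \<Rightarrow> real^'n^'n"
  assumes A: "ct_chain A"
  defines "\<C> \<equiv> {C \<in> graph_components (infinite_flow_graph A). 2 \<le> card C}"
  obtains s P Q where "\<forall>k. 0 \<le> s k" "(\<lambda>k::nat. state_transition A (s k) 0) \<longlonglongrightarrow> P" "Q ** P = P"
    "\<forall>C\<in>\<C>. det (block C Q) = 0 \<and> (\<forall>i j. i \<notin> C \<longrightarrow> j \<in> C \<longrightarrow> Q $ i $ j = 0)"
proof -
  let ?\<Phi> = "state_transition A"
  obtain r P where r: "strict_mono (r :: nat \<Rightarrow> nat)" and P: "(\<lambda>k. ?\<Phi> (real (r k)) 0) \<longlonglongrightarrow> P"
    using matrix_convergent_subsequence[of "\<lambda>k. ?\<Phi> (real k) 0"]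
      state_transition_entry_abs_le[OF A order_refl] by (metis of_nat_0_le_iff)
  define s where "s k = real (r k)" for k
  have s: "filterlim s at_top sequentially"
    unfolding s_def by (rule filterlim_compose[OF filterlim_real_sequentially filterlim_subseq[OF r]])
  let ?good = "\<lambda>e \<tau> t. \<forall>C\<in>\<C>. (det (block C (?\<Phi> t \<tau>)))\<^sup>2 \<le> e \<and>
                  (\<forall>i j. i \<notin> C \<longrightarrow> j \<in> C \<longrightarrow> \<bar>?\<Phi> t \<tau> $ i $ j\<bar> \<le> e)"
  have "\<exists>k l. n \<le> k \<and> n \<le> l \<and> s k \<le> s l \<and> ?good (1 / Suc n) (s k) (s l)" for n
  proof -
    have "\<forall>\<^sub>F \<tau> in at_top. \<forall>C\<in>\<C>. \<forall>\<^sub>F t in at_top. (det (block C (?\<Phi> t \<tau>)))\<^sup>2 \<le> 1 / Suc n \<and>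
                  (\<forall>i j. i \<notin> C \<longrightarrow> j \<in> C \<longrightarrow> \<bar>?\<Phi> t \<tau> $ i $ j\<bar> \<le> 1 / Suc n)"
      unfolding \<C>_def
      by (intro eventually_ball_finite ballI eventually_state_transition_component[OF A]) auto
    then have "\<forall>\<^sub>F \<tau> in at_top. \<forall>\<^sub>F t in at_top. ?good (1 / Suc n) \<tau> t"
      by (rule eventually_mono) (intro eventually_ball_finite, auto)
    then have "\<forall>\<^sub>F k in sequentially. \<forall>\<^sub>F t in at_top. ?good (1 / Suc n) (s k) t"
      using s by (rule eventually_compose_filterlim)
    then have "\<forall>\<^sub>F k in sequentially. n \<le> k \<and> (\<forall>\<^sub>F t in at_top. ?good (1 / Suc n) (s k) t)"
      by (intro eventually_conj eventually_ge_at_top)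
    then obtain k where k: "n \<le> k" "\<forall>\<^sub>F t in at_top. ?good (1 / Suc n) (s k) t"
      using eventually_happens[of _ sequentially] by auto
    have "\<forall>\<^sub>F t in at_top. s k \<le> t \<and> ?good (1 / Suc n) (s k) t"
      by (rule eventually_conj[OF eventually_ge_at_top k(2)])
    then have "\<forall>\<^sub>F l in sequentially. s k \<le> s l \<and> ?good (1 / Suc n) (s k) (s l)"
      using s by (rule eventually_compose_filterlim)
    then have "\<forall>\<^sub>F l in sequentially. n \<le> l \<and> s k \<le> s l \<and> ?good (1 / Suc n) (s k) (s l)"
      by (rule eventually_conj[OF eventually_ge_at_top])
    from eventually_happens[OF this] obtain l where "n \<le> l \<and> s k \<le> s l \<and> ?good (1 / Suc n) (s k) (s l)"
      by auto
    with k(1) show ?thesis by blast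
  qed
  then have "\<forall>n. \<exists>k l. n \<le> k \<and> n \<le> l \<and> s k \<le> s l \<and> ?good (1 / Suc n) (s k) (s l)"
    by (rule allI)
  from choice[OF this] obtain k where
    "\<forall>n. \<exists>l. n \<le> k n \<and> n \<le> l \<and> s (k n) \<le> s l \<and> ?good (1 / Suc n) (s (k n)) (s l)" ..
  from choice[OF this] obtain l where
    "\<forall>n. n \<le> k n \<and> n \<le> l n \<and> s (k n) \<le> s (l n) \<and> ?good (1 / Suc n) (s (k n)) (s (l n))" ..
  then have kl: "\<And>n. n \<le> k n" "\<And>n. n \<le> l n" "\<And>n. s (k n) \<le> s (l n)"
      and good: "\<And>n. ?good (1 / Suc n) (s (k n)) (s (l n))"
    by simp_all
  have s_nonneg: "0 \<le> s n" for n by (simp add: s_def)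
  define R where "R n = ?\<Phi> (s (l n)) (s (k n))" for n
  obtain q Q where q: "strict_mono (q :: nat \<Rightarrow> nat)" and Q: "(\<lambda>n. R (q n)) \<longlonglongrightarrow> Q"
    using matrix_convergent_subsequence[of R] state_transition_entry_abs_le[OF A s_nonneg kl(3)]
    unfolding R_def by metis
  \<comment> \<open>The chosen index maps need not be monotone; lying above the identity is enough
    to retain the limit \<open>P\<close>.\<close>
  have sub: "(\<lambda>n. ?\<Phi> (s (f (q n))) 0) \<longlonglongrightarrow> P" if "\<And>n. n \<le> f n" for f
  proof -
    have "filterlim f sequentially sequentially"
      by (rule filterlim_at_top_mono[OF filterlim_ident]) (use that in auto)
    then have "filterlim (\<lambda>n. f (q n)) sequentially sequentially"
      by (rule filterlim_compose[OF _ filterlim_subseq[OF q]])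
    then show ?thesis
      using filterlim_compose[OF P] by (simp add: s_def)
  qed
  have "(\<lambda>n. R (q n) ** ?\<Phi> (s (k (q n))) 0) \<longlonglongrightarrow> Q ** P"
    by (rule tendsto_matrix_mult[OF Q sub[OF kl(1)]])
  moreover have "R (q n) ** ?\<Phi> (s (k (q n))) 0 = ?\<Phi> (s (l (q n))) 0" for n
    unfolding R_def by (rule state_transition_mult[OF A order_refl s_nonneg kl(3)])
  ultimately have "Q ** P = P"
    using sub[OF kl(2)] LIMSEQ_unique by simp
  have inv: "(\<lambda>n. 1 / real (Suc (q n))) \<longlonglongrightarrow> 0"
    using LIMSEQ_subseq_LIMSEQ[OF LIMSEQ_inverse_real_of_nat q] by (simp add: o_def inverse_eq_divide)
  have det_zero: "det (block C Q) = 0" if "C \<in> \<C>" for C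
  proof -
    have "(\<lambda>n. (det (block C (R (q n))))\<^sup>2) \<longlonglongrightarrow> (det (block C Q))\<^sup>2"
      by (intro tendsto_power tendsto_det tendsto_block Q)
    moreover have "(det (block C (R (q n))))\<^sup>2 \<le> 1 / real (Suc (q n))" for n
      using good[of "q n"] that unfolding R_def by blast
    ultimately have "(det (block C Q))\<^sup>2 \<le> 0"
      using inv by (intro LIMSEQ_le) auto
    then show ?thesis by simp
  qed
  have off_zero: "Q $ i $ j = 0" if "C \<in> \<C>" "i \<notin> C" "j \<in> C" for C i j
  proof -
    have "(\<lambda>n. \<bar>R (q n) $ i $ j\<bar>) \<longlonglongrightarrow> \<bar>Q $ i $ j\<bar>"
      using Q by (intro tendsto_rabs) (simp add: tendsto_matrix_iff)
    moreover have "\<bar>R (q n) $ i $ j\<bar> \<le> 1 / real (Suc (q n))" for n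
      using good[of "q n"] that unfolding R_def by blast
    ultimately have "\<bar>Q $ i $ j\<bar> \<le> 0"
      using inv by (intro LIMSEQ_le) auto
    then show ?thesis by simp
  qed
  have "\<forall>C\<in>\<C>. det (block C Q) = 0 \<and> (\<forall>i j. i \<notin> C \<longrightarrow> j \<in> C \<longrightarrow> Q $ i $ j = 0)"
    using det_zero off_zero by blast
  moreover have "(\<lambda>n. ?\<Phi> (s n) 0) \<longlonglongrightarrow> P"
    using P by (simp add: s_def)
  ultimately show ?thesis
    using that[of s P Q] s_nonneg \<open>Q ** P = P\<close> by simp
qed

theorem proposition1:
  fixes A :: "real \<Rightarrow> real^'n^'n"
  assumes "ct_chain A"
  shows "chain_rank A \<le> CARD('n) - num_nontrivial_components (infinite_flow_graph A)"
proof -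
  let ?\<C> = "{C \<in> graph_components (infinite_flow_graph A). 2 \<le> card C}"
  obtain s P Q where s: "\<forall>k. 0 \<le> s k" and P: "(\<lambda>k::nat. state_transition A (s k) 0) \<longlonglongrightarrow> P"
    and QP: "Q ** P = P"
    and Q: "\<forall>C\<in>?\<C>. det (block C Q) = 0 \<and> (\<forall>i j. i \<notin> C \<longrightarrow> j \<in> C \<longrightarrow> Q $ i $ j = 0)"
    using ex_limit_matrices[OF assms] .
  have "card ?\<C> \<le> dim {x. Q *v x = 0}"
  proof (rule card_le_dim_if_disjoint_supports)
    show "disjoint ?\<C>"
      using disjoint_graph_components[OF sym_infinite_flow_graph[of A]] by (auto simp: disjoint_def)
    fix C assume "C \<in> ?\<C>"
    with Q have "det (block C Q) = 0" "\<And>i j. \<lbrakk>i \<notin> C; j \<in> C\<rbrakk> \<Longrightarrow> Q $ i $ j = 0"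
      by blast+
    then obtain w where "w \<noteq> 0" "Q *v w = 0" "\<forall>i. i \<notin> C \<longrightarrow> w $ i = 0"
      by (rule kernel_vector_supported_on_block)
    then show "\<exists>w\<in>{x. Q *v x = 0}. w \<noteq> 0 \<and> (\<forall>i. i \<notin> C \<longrightarrow> w $ i = 0)" by blast
  qed
  also have "\<dots> \<le> dim {x. P *v x = 0}"
    using dim_kernel_plus_rank[of Q] dim_kernel_plus_rank[of P] rank_mul_le_left[of Q P] QP by simp
  also have "\<dots> \<le> dim (null_space A 0)"
    using null_space_limit[OF assms s[rule_format] P] by (intro dim_subset) auto
  \<comment> \<open>The chain of inequalities bounds the number of components by a dimension, hence
    by \<open>CARD('n)\<close>, so the truncated subtraction in the claim loses nothing.\<close>
  finally show ?thesis
    unfolding chain_rank_def chain_nullity_def num_nontrivial_components_def by (rule diff_le_mono2)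
qed

end
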